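(* Assume (EC), (ER) and (PR). Let $u_n,u\in\mathcal U$ satisfy $u_n(x)\to u(x)$ as $n\to\infty$ for each $x\in E$, and assume that for each $x\in E$ $$\sup_{B\in\mathcal E}|P^{u_n(x)}(x,B)-P^{u(x)}(x,B)|\to 0\quad\text{as } n\to\infty .$$ Let $c:E\times U\to\mathbb R$ be bounded, measurable, and continuous with respect to the second variable. Then $$\sup_{B\in\mathcal E}|\pi^{u_n}(B)-\pi^u(B)|\to 0$$ and, for every $x\in E$, $$J_x(u_n)\to J_x(u)=\int_E c(y,u(y))\,\pi^u(dy)$$ as $n\to\infty$.
   Context: $E$ is a Polish space (with a fixed metric) with Borel $\sigma$-field $\mathcal E$; $U$ is a compact set of control parameters; $\mathcal U$ is a family of Borel measurable mappings $u:E\to U$ (Markov controls). For $a\in U$, $P^a(x,\cdot)$ denotes the transition kernel on $E$ under constant control $a$. For each $u\in\mathcal U$, $(X_t^u)_{t=0,1,2,\dots}$ is the discrete-time Markov process on $E$ with transition kernel $P^{u(x)}(x,dy)$ (assumed to be a Markov kernel); $P_x^u$, $E_x^u$ denote probability and expectation when the process starts at $x$, and $\theta_t$ is the time shift. $R\subset R_1$ are two fixed concentric balls in $E$. For $B\in\mathcal E$ let $D_B=\inf\{s\ge0:X_s\in B\}$ and $\tau_B=D_{R_1^c}+D_B\circ\theta_{D_{R_1^c}}$, the first time the process enters $B$ after entering the complement of $R_1$. For $x\in R$ and $B\in\mathcal B(R)$ (Borel subsets of $R$), $\Pi^u(x,B):=P_x^u\{X^u_{\tau_R}\in B\}$. (EC):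 $\ \sup_{x\in R}\sup_{u\in\mathcal U}E_x^u\{(\tau_R)^2\}<\infty$. (ER): $\ \sup_{x,x'\in R}\sup_{u\in\mathcal U}\sup_{B\in\mathcal B(R)}|\Pi^u(x,B)-\Pi^u(x',B)|=:\Delta_R<1$. (PR): $\ \sup_{x\in E}\sup_{u\in\mathcal U}E_x^u\{D_R\}<\infty$. Under (ER), for each $u\in\mathcal U$ there is a unique invariant probability measure $\mu^u$ on $R$ for $\Pi^u$. Under (EC), (ER), (PR), for each $u\in\mathcal U$ the process $(X^u_t)$ has a unique invariant probability measure $\pi^u$, and $$\pi^u(B)=\frac{\int_R E_x^u\{\sum_{i=0}^{\tau_R-1}1_B(X_i^u)\}\mu^u(dx)}{\int_R E_x^u\{\tau_R\}\mu^u(dx)},\qquad B\in\mathcal E .$$ The long run average functional is $$J_x(u)=\liminf_{n\to\infty}\frac1n E_x^u\Big\{\sum_{i=0}^{n-1}c(X_i^u,u(X_i^u))\Big\}.$$ *)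

theory Defs
  imports "HOL-Probability.Probability"
begin

abbreviation markov_kernel :: "('a::topological_space \<Rightarrow> 'a measure) \<Rightarrow> bool" where
  "markov_kernel K \<equiv> K \<in> borel \<rightarrow>\<^sub>M prob_algebra borel"

definition ctrl_kernel :: "('b \<Rightarrow> 'a \<Rightarrow> 'a measure) \<Rightarrow> ('a \<Rightarrow> 'b) \<Rightarrow> 'a \<Rightarrow> 'a measure" where
  "ctrl_kernel P u x = P (u x) x"

text \<open>
  Law on the path space \<^typ>\<open>nat \<Rightarrow> 'a\<close> of the chain with kernel \<open>K\<close> started at \<open>x\<close>, by the
  Ionescu Tulcea construction: coordinate \<open>i\<close>, given the path \<open>\<omega>\<close> on \<open>{0..<i}\<close>, is drawn from
  \<open>chain_step K x i \<omega>\<close>. The process at time \<open>t\<close> is the coordinate map \<open>\<lambda>\<omega>. \<omega> t\<close>.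
\<close>

definition chain_step :: "('a::topological_space \<Rightarrow> 'a measure) \<Rightarrow> 'a \<Rightarrow> nat \<Rightarrow> (nat \<Rightarrow> 'a) \<Rightarrow> 'a measure" where
  "chain_step K x i \<omega> = (case i of 0 \<Rightarrow> return borel x | Suc j \<Rightarrow> K (\<omega> j))"

definition chain_law :: "('a::topological_space \<Rightarrow> 'a measure) \<Rightarrow> 'a \<Rightarrow> (nat \<Rightarrow> 'a) measure" where
  "chain_law K x =
     projective_family.lim UNIV (Ionescu_Tulcea.CI (chain_step K x) (\<lambda>_. borel)) (\<lambda>_. borel)"

lemma Ionescu_Tulcea_chain_step:
  fixes K :: "'a::topological_space \<Rightarrow> 'a measure"
  assumes K: "markov_kernel K"
  shows "Ionescu_Tulcea (chain_step K x) (\<lambda>_. borel)"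
proof (rule Ionescu_Tulcea.intro)
  fix i
  have K': "K \<in> borel \<rightarrow>\<^sub>M subprob_algebra borel"
    using K by (rule measurable_prob_algebraD)
  show "chain_step K x i \<in> PiM {0..<i} (\<lambda>_. borel) \<rightarrow>\<^sub>M subprob_algebra borel"
  proof (cases i)
    case 0
    have "subprob_space (return borel x)"
      by (intro prob_space_imp_subprob_space prob_space_return) simp
    then show ?thesis
      using 0 by (simp add: chain_step_def[abs_def] space_subprob_algebra)
  next
    case (Suc j)
    have "(\<lambda>\<omega>. \<omega> j) \<in> PiM {0..<i} (\<lambda>_. borel :: 'a measure) \<rightarrow>\<^sub>M borel"
      by (rule measurable_component_singleton) (simp add: Suc)
    from measurable_compose[OF this K'] show ?thesis
      by (simp add: chain_step_def[abs_def] Suc)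
  qed
next
  fix i :: nat and \<omega> :: "nat \<Rightarrow> 'a"
  have "prob_space (K y)" for y
    using measurable_space[OF K, of y] by (simp add: space_prob_algebra)
  moreover have "prob_space (return borel x)"
    by (rule prob_space_return) simp
  ultimately show "prob_space (chain_step K x i \<omega>)"
    by (simp add: chain_step_def split: nat.split)
qed

abbreviation path_law ::
    "('b \<Rightarrow> 'a \<Rightarrow> 'a measure) \<Rightarrow> ('a \<Rightarrow> 'b) \<Rightarrow> 'a::topological_space \<Rightarrow> (nat \<Rightarrow> 'a) measure" where
  "path_law P u x \<equiv> chain_law (ctrl_kernel P u) x"

definition invariant_prob :: "('a::topological_space \<Rightarrow> 'a measure) \<Rightarrow> 'a measure \<Rightarrow> bool" where
  "invariant_prob K \<pi> \<longleftrightarrow>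
     prob_space \<pi> \<and> sets \<pi> = sets borel \<and>
     (\<forall>B\<in>sets borel. emeasure \<pi> B = (\<integral>\<^sup>+x. emeasure (K x) B \<partial>\<pi>))"

definition inv_law :: "('b \<Rightarrow> 'a \<Rightarrow> 'a measure) \<Rightarrow> ('a::topological_space \<Rightarrow> 'b) \<Rightarrow> 'a measure" where
  "inv_law P u = (THE \<pi>. invariant_prob (ctrl_kernel P u) \<pi>)"


definition hit :: "'a set \<Rightarrow> (nat \<Rightarrow> 'a) \<Rightarrow> enat" where
  "hit B \<omega> = (INF s\<in>{s. \<omega> s \<in> B}. enat s)"

definition shift :: "nat \<Rightarrow> (nat \<Rightarrow> 'a) \<Rightarrow> (nat \<Rightarrow> 'a)" where
  "shift t \<omega> = (\<lambda>s. \<omega> (s + t))"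

definition cycle_time :: "'a set \<Rightarrow> 'a set \<Rightarrow> (nat \<Rightarrow> 'a) \<Rightarrow> enat" where
  "cycle_time R1 B \<omega> =
     (case hit (- R1) \<omega> of enat t \<Rightarrow> enat t + hit B (shift t \<omega>) | \<infinity> \<Rightarrow> \<infinity>)"

text \<open>Paths with infinite cycle time do not contribute to the return kernel.\<close>

definition return_prob ::
    "('b \<Rightarrow> 'a \<Rightarrow> 'a measure) \<Rightarrow> 'a set \<Rightarrow> 'a set \<Rightarrow> ('a \<Rightarrow> 'b) \<Rightarrow> 'a::topological_space \<Rightarrow> 'a set \<Rightarrow> real" where
  "return_prob P R R1 u x B =
     measure (path_law P u x) {\<omega>. \<exists>t. cycle_time R1 R \<omega> = enat t \<and> \<omega> t \<in> B}"

text \<open>Open and closed balls are both admitted; \<^term>\<open>R \<subseteq> R1\<close> is required separately.\<close>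

definition concentric_balls :: "'a::metric_space set \<Rightarrow> 'a set \<Rightarrow> bool" where
  "concentric_balls R R1 \<longleftrightarrow>
     (\<exists>z r r1. 0 < r \<and> 0 < r1 \<and> R \<in> {ball z r, cball z r} \<and> R1 \<in> {ball z r1, cball z r1})"

definition cond_EC ::
    "('b \<Rightarrow> 'a \<Rightarrow> 'a measure) \<Rightarrow> ('a \<Rightarrow> 'b) set \<Rightarrow> 'a::topological_space set \<Rightarrow> 'a set \<Rightarrow> bool" where
  "cond_EC P \<U> R R1 \<longleftrightarrow>
     (SUP x\<in>R. SUP u\<in>\<U>. \<integral>\<^sup>+\<omega>. (ennreal_of_enat (cycle_time R1 R \<omega>))\<^sup>2 \<partial>path_law P u x) < \<infinity>"

definition cond_ER ::
    "('b \<Rightarrow> 'a \<Rightarrow> 'a measure) \<Rightarrow> ('a \<Rightarrow> 'b) set \<Rightarrow> 'a::topological_space set \<Rightarrow> 'a set \<Rightarrow> bool" where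
  "cond_ER P \<U> R R1 \<longleftrightarrow>
     (SUP x\<in>R. SUP x'\<in>R. SUP u\<in>\<U>. SUP B\<in>sets (restrict_space borel R).
        \<bar>return_prob P R R1 u x B - return_prob P R R1 u x' B\<bar>) < 1"

definition cond_PR ::
    "('b \<Rightarrow> 'a \<Rightarrow> 'a measure) \<Rightarrow> ('a \<Rightarrow> 'b) set \<Rightarrow> 'a::topological_space set \<Rightarrow> bool" where
  "cond_PR P \<U> R \<longleftrightarrow>
     (SUP x. SUP u\<in>\<U>. \<integral>\<^sup>+\<omega>. ennreal_of_enat (hit R \<omega>) \<partial>path_law P u x) < \<infinity>"


definition avg_cost ::
    "('b \<Rightarrow> 'a \<Rightarrow> 'a measure) \<Rightarrow> ('a \<Rightarrow> 'b \<Rightarrow> real) \<Rightarrow> 'a::topological_space \<Rightarrow> ('a \<Rightarrow> 'b) \<Rightarrow> ereal" where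
  "avg_cost P c x u =
     liminf (\<lambda>n. ereal ((1 / real n) * (\<integral>\<omega>. (\<Sum>i<n. c (\<omega> i) (u (\<omega> i))) \<partial>path_law P u x)))"

end

(*
  Write S_n f = sum of K^i f over i < n, with |f| <= 1. Since K (S_n f) - S_n f = K^n f - f is
  bounded by 2, Dynkin's formula gives |E_x (S_n f)(X_T) - S_n f x| <= 2 E_x T for every stopping
  time T. Taking for T the end of a cycle, (ER) shows that the oscillation D of S_n f on R satisfies
  D <= Delta D + 4 sup E T, so it is bounded uniformly in n, f and the control; taking for T the
  hitting time of R, (PR) extends this to all of E. Hence n |-> S_n f x is additive up to a bounded
  error, and S_n f x / n is within C / n of a limit, which is the integral of f under the unique
  invariant law. As C does not depend on the control, convergence of the invariant laws in total
  variation reduces to that of S_n f x for a fixed n, which follows from dominated convergence.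
*)
theory Submission
  imports Defs
begin

section \<open>Integrals and total variation\<close>

text \<open>The invariant law is also a ratio of integrals over one cycle, but perturbing that ratio
  means passing to the limit in functionals of an unbounded random time and in the invariant law of
  the return kernel. A fixed horizon n avoids both: the error C / n covers all later times,
  uniformly in the control, and only finitely many kernels are composed when u_n replaces u. A fixed
  horizon also closes the contraction. The inequality for D yields a bound only if D is known to be
  finite, which |S_n f| <= n ensures, although the resulting bound no longer contains n. For the
  same inequality the difference of two integrals must be at most total variation times oscillation
  with constant 1; a factor 2 would demand Delta < 1/2. Existence of the invariant law rests on the
  same rate: averages converging uniformly over Borel sets have a countably additive limit, which
  takes the place of tightness and the Feller property.\<close>

text \<open>The sets are superlevel sets, and x lies in exactly floor (N * f x) of them. Equal
  weights 1 / N let a bound valid for every single set pass to \<open>f\<close> with the same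
  constant.\<close>

lemma step_approximation:
  fixes f :: "'a \<Rightarrow> real"
  assumes f: "f \<in> borel_measurable M" and f01: "\<And>x. 0 \<le> f x" "\<And>x. f x \<le> 1" and N: "0 < (N::nat)"
  obtains A :: "nat \<Rightarrow> 'a set"
  where "\<And>k. A k \<in> sets M"
    "\<And>x. x \<in> space M \<Longrightarrow> \<bar>f x - (\<Sum>k<N. indicator (A k) x) / N\<bar> \<le> 1 / N"
proof
  let ?A = "\<lambda>k. {x \<in> space M. real (Suc k) \<le> N * f x}"
  show "?A k \<in> sets M" for k
    using f by measurable
  fix x assume x: "x \<in> space M"
  define m where "m = nat \<lfloor>N * f x\<rfloor>"
  have nn: "0 \<le> N * f x" using f01 by simp
  have m: "real m \<le> N * f x" "N * f x < real m + 1"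
    using nn unfolding m_def by linarith+
  have "real m \<le> N" using m(1) f01(2)[of x] N
    by (meson mult_left_le of_nat_0_le_iff order_trans)
  then have mN: "m \<le> N" by simp
  have "(\<Sum>k<N. indicator (?A k) x) = (\<Sum>k<N. if k < m then 1 else (0::real))"
  proof (intro sum.cong refl)
    fix k
    have "real (Suc k) \<le> N * f x \<longleftrightarrow> k < m"
    proof (cases "k < m")
      case True
      then have "real (Suc k) \<le> real m" by simp
      then show ?thesis using m True by linarith
    next
      case False
      then have "real m + 1 \<le> real (Suc k)" by simp
      then show ?thesis using m False by linarith
    qed
    then show "indicator (?A k) x = (if k < m then 1 else (0::real))"
      using x by (simp add: indicator_def)
  qed
  also have "\<dots> = real (card {k. k < N \<and> k < m})"
    by (simp add: sum.If_cases Int_def)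
  also have "{k. k < N \<and> k < m} = {..<m}" using mN by auto
  finally have "(\<Sum>k<N. indicator (?A k) x) = real m" by simp
  then show "\<bar>f x - (\<Sum>k<N. indicator (?A k) x) / N\<bar> \<le> 1 / N"
  proof -
    have "f x - real m / N = (N * f x - m) / N" using N by (simp add: field_simps)
    also have "\<bar>\<dots>\<bar> \<le> 1 / N" using m N by (simp add: divide_right_mono)
    finally show ?thesis
      using \<open>(\<Sum>k<N. indicator (?A k) x) = real m\<close> by simp
  qed
qed

lemma (in prob_space) integrable_bounded:
  fixes f :: "'a \<Rightarrow> real"
  assumes "f \<in> borel_measurable M" "\<And>x. \<bar>f x\<bar> \<le> b"
  shows "integrable M f"
  using assms by (intro integrable_const_bound[of _ b]) auto

lemma (in prob_space) abs_expectation_le: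
  fixes f :: "'a \<Rightarrow> real"
  assumes "f \<in> borel_measurable M" "\<And>x. \<bar>f x\<bar> \<le> b"
  shows "\<bar>expectation f\<bar> \<le> b"
proof -
  have "\<bar>expectation f\<bar> \<le> expectation (\<lambda>x. \<bar>f x\<bar>)"
    by (rule integral_abs_bound)
  also have "\<dots> \<le> expectation (\<lambda>x. b)"
    using assms by (intro integral_mono integrable_bounded[of "\<lambda>x. \<bar>f x\<bar>" b]) auto
  finally show ?thesis by (simp add: prob_space)
qed

lemma (in prob_space) abs_expectation_diff_le:
  fixes f g :: "'a \<Rightarrow> real"
  assumes "integrable M f" "integrable M g" "\<And>x. x \<in> space M \<Longrightarrow> \<bar>f x - g x\<bar> \<le> b"
  shows "\<bar>expectation f - expectation g\<bar> \<le> b"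
proof -
  have "\<bar>expectation f - expectation g\<bar> \<le> expectation (\<lambda>x. \<bar>f x - g x\<bar>)"
    using assms(1,2) integral_abs_bound[of M "\<lambda>x. f x - g x"] by simp
  also have "\<dots> \<le> expectation (\<lambda>x. b)"
    using assms by (intro integral_mono) auto
  finally show ?thesis by (simp add: prob_space)
qed

text \<open>Up to 1 / N, \<open>f\<close> is an average of N indicators, each contributing at most
  \<open>d\<close>; as N is arbitrary, the constant remains \<open>d\<close>.\<close>

lemma total_variation_integral_unit:
  fixes f :: "'a \<Rightarrow> real"
  assumes \<mu>: "prob_space \<mu>" "sets \<mu> = sets M" and \<nu>: "prob_space \<nu>" "sets \<nu> = sets M"
    and f: "f \<in> borel_measurable M" and f01: "\<And>x. 0 \<le> f x" "\<And>x. f x \<le> 1"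
    and d: "\<And>B. B \<in> sets M \<Longrightarrow> \<bar>measure \<mu> B - measure \<nu> B\<bar> \<le> d"
  shows "\<bar>(\<integral>x. f x \<partial>\<mu>) - (\<integral>x. f x \<partial>\<nu>)\<bar> \<le> d"
proof -
  interpret \<mu>: prob_space \<mu> by fact
  interpret \<nu>: prob_space \<nu> by fact
  have sp: "space \<mu> = space M" "space \<nu> = space M"
    using \<mu> \<nu> sets_eq_imp_space_eq by blast+
  have bound: "\<bar>(\<integral>x. f x \<partial>\<mu>) - (\<integral>x. f x \<partial>\<nu>)\<bar> \<le> 2 / N + d" if N: "0 < N" for N :: nat
  proof -
    obtain A where A: "\<And>k. A k \<in> sets M"
      and fA: "\<And>x. x \<in> space M \<Longrightarrow> \<bar>f x - (\<Sum>k<N. indicator (A k) x) / N\<bar> \<le> 1 / N"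
      using step_approximation[OF f f01 N] by metis
    let ?g = "\<lambda>x. (\<Sum>k<N. indicator (A k) x) / N :: real"
    have fb: "\<bar>f x\<bar> \<le> 1" for x using f01[of x] by simp
    have f': "f \<in> borel_measurable \<mu>" "f \<in> borel_measurable \<nu>"
      using f by (simp_all add: measurable_cong_sets[OF \<mu>(2) refl] measurable_cong_sets[OF \<nu>(2) refl])
    have iA: "integrable \<mu> (indicator (A k) :: 'a \<Rightarrow> real)" "integrable \<nu> (indicator (A k) :: 'a \<Rightarrow> real)" for k
      using A \<mu> \<nu> by (auto intro!: integrable_real_indicator simp: less_top[symmetric])
    have i: "integrable \<mu> ?g" "integrable \<nu> ?g"
      using iA by simp_all
    have 1: "\<bar>(\<integral>x. f x \<partial>\<mu>) - (\<integral>x. ?g x \<partial>\<mu>)\<bar> \<le> 1 / N"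
      by (rule \<mu>.abs_expectation_diff_le[OF \<mu>.integrable_bounded[OF f'(1) fb] i(1)]) (use fA sp in simp)
    have 3: "\<bar>(\<integral>x. f x \<partial>\<nu>) - (\<integral>x. ?g x \<partial>\<nu>)\<bar> \<le> 1 / N"
      by (rule \<nu>.abs_expectation_diff_le[OF \<nu>.integrable_bounded[OF f'(2) fb] i(2)]) (use fA sp in simp)
    have "(\<integral>x. ?g x \<partial>\<mu>) = (\<Sum>k<N. measure \<mu> (A k)) / N" "(\<integral>x. ?g x \<partial>\<nu>) = (\<Sum>k<N. measure \<nu> (A k)) / N"
      using iA A \<mu> \<nu> by simp_all
    then have "(\<integral>x. ?g x \<partial>\<mu>) - (\<integral>x. ?g x \<partial>\<nu>) = (\<Sum>k<N. measure \<mu> (A k) - measure \<nu> (A k)) / N"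
      by (simp only: sum_subtractf diff_divide_distrib)
    moreover have "\<bar>\<Sum>k<N. measure \<mu> (A k) - measure \<nu> (A k)\<bar> \<le> (\<Sum>k<N. d)"
      by (intro order_trans[OF sum_abs] sum_mono d A)
    ultimately have 2: "\<bar>(\<integral>x. ?g x \<partial>\<mu>) - (\<integral>x. ?g x \<partial>\<nu>)\<bar> \<le> d"
      using N by (simp add: field_simps)
    show ?thesis using 1 2 3 by (simp add: abs_le_iff)
  qed
  have "(\<lambda>n. 2 / real (Suc n) + d) \<longlonglongrightarrow> 0 + d"
    by (intro tendsto_intros LIMSEQ_Suc lim_const_over_n)
  then have "\<bar>(\<integral>x. f x \<partial>\<mu>) - (\<integral>x. f x \<partial>\<nu>)\<bar> \<le> 0 + d"
    by (rule LIMSEQ_le_const) (use bound[of "Suc n" for n] in auto)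
  then show ?thesis by simp
qed

text \<open>Both measures have mass 1, so additive constants cancel and only the width b - a of the
  range counts.\<close>

lemma total_variation_integral:
  fixes f :: "'a \<Rightarrow> real"
  assumes \<mu>: "prob_space \<mu>" "sets \<mu> = sets M" and \<nu>: "prob_space \<nu>" "sets \<nu> = sets M"
    and f: "f \<in> borel_measurable M" and fab: "\<And>x. a \<le> f x" "\<And>x. f x \<le> b"
    and d: "\<And>B. B \<in> sets M \<Longrightarrow> \<bar>measure \<mu> B - measure \<nu> B\<bar> \<le> d"
  shows "\<bar>(\<integral>x. f x \<partial>\<mu>) - (\<integral>x. f x \<partial>\<nu>)\<bar> \<le> d * (b - a)"
proof (cases "a = b")
  case True
  then have "f = (\<lambda>_. b)" using fab by (intro ext antisym) auto
  then show ?thesis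
    using True \<mu>(1) \<nu>(1) by (simp add: prob_space.prob_space)
next
  case False
  then have ab: "a < b" using fab[of undefined] by simp
  interpret \<mu>: prob_space \<mu> by fact
  interpret \<nu>: prob_space \<nu> by fact
  let ?g = "\<lambda>x. (f x - a) / (b - a)"
  have fb: "\<bar>f x\<bar> \<le> \<bar>a\<bar> + \<bar>b\<bar>" for x using fab[of x] by simp
  have f': "f \<in> borel_measurable \<mu>" "f \<in> borel_measurable \<nu>"
    using f by (simp_all add: measurable_cong_sets[OF \<mu>(2) refl] measurable_cong_sets[OF \<nu>(2) refl])
  have i: "integrable \<mu> f" "integrable \<nu> f"
    using f' fb by (auto intro: \<mu>.integrable_bounded \<nu>.integrable_bounded)
  have "\<bar>(\<integral>x. ?g x \<partial>\<mu>) - (\<integral>x. ?g x \<partial>\<nu>)\<bar> \<le> d"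
    using fab f ab d by (intro total_variation_integral_unit[OF \<mu> \<nu>]) auto
  moreover have "(\<integral>x. ?g x \<partial>\<mu>) = ((\<integral>x. f x \<partial>\<mu>) - a) / (b - a)"
    using i by (simp add: \<mu>.prob_space)
  moreover have "(\<integral>x. ?g x \<partial>\<nu>) = ((\<integral>x. f x \<partial>\<nu>) - a) / (b - a)"
    using i by (simp add: \<nu>.prob_space)
  moreover have "(p - a) / (b - a) - (q - a) / (b - a) = (p - q) / (b - a)" for p q
    by (simp add: diff_divide_distrib[symmetric])
  ultimately have "\<bar>((\<integral>x. f x \<partial>\<mu>) - (\<integral>x. f x \<partial>\<nu>)) / (b - a)\<bar> \<le> d"
    by (simp only:)
  then show ?thesis
    using ab by (simp add: pos_divide_le_eq)
qed

text \<open>Finite additivity passes to the limit set by set. Countable additivity uses the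
  uniformity over B: along sets decreasing to the empty set, one n with small \<open>e n\<close> is
  kept fixed, and \<open>\<mu> n\<close> is continuous from above.\<close>

lemma uniform_limit_prob_space:
  fixes \<mu> :: "nat \<Rightarrow> 'a measure"
  assumes \<mu>: "\<And>n. prob_space (\<mu> n)" "\<And>n. sets (\<mu> n) = sets M" and e: "e \<longlonglongrightarrow> 0"
    and near: "\<And>n B. B \<in> sets M \<Longrightarrow> \<bar>measure (\<mu> n) B - l B\<bar> \<le> e n"
  obtains \<pi> where "prob_space \<pi>" "sets \<pi> = sets M" "\<And>B. B \<in> sets M \<Longrightarrow> measure \<pi> B = l B"
proof -
  have fin: "finite_measure (\<mu> n)" for n
    using \<mu>(1)[of n] by (rule prob_space.finite_measure)
  have sp: "space (\<mu> n) = space M" for n using \<mu>(2) by (rule sets_eq_imp_space_eq)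
  have lim: "(\<lambda>n. measure (\<mu> n) B) \<longlonglongrightarrow> l B" if "B \<in> sets M" for B
    by (rule LIM_zero_cancel, rule Lim_null_comparison[OF _ e]) (use near[OF that] in simp)
  have nonneg: "0 \<le> l B" if "B \<in> sets M" for B
    using lim[OF that] by (rule LIMSEQ_le_const) simp
  have empty: "l {} = 0"
    using lim[of "{}"] by (simp add: LIMSEQ_const_iff)
  have total: "l (space M) = 1"
    using lim[of "space M"] prob_space.prob_space[OF \<mu>(1)] sp by (simp add: LIMSEQ_const_iff)
  have add: "l (A \<union> B) = l A + l B" if "A \<in> sets M" "B \<in> sets M" "A \<inter> B = {}" for A B
  proof (rule LIMSEQ_unique)
    show "(\<lambda>n. measure (\<mu> n) (A \<union> B)) \<longlonglongrightarrow> l (A \<union> B)"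
      using that by (intro lim) auto
    have "measure (\<mu> n) (A \<union> B) = measure (\<mu> n) A + measure (\<mu> n) B" for n
      using that \<mu>(2) by (intro finite_measure.finite_measure_Union[OF fin]) auto
    then show "(\<lambda>n. measure (\<mu> n) (A \<union> B)) \<longlonglongrightarrow> l A + l B"
      using that by (simp add: tendsto_add lim)
  qed
  let ?l = "\<lambda>B. ennreal (l B)"
  have pos: "positive (sets M) ?l" by (simp add: positive_def empty)
  have ca: "countably_additive (sets M) ?l"
  proof (rule sets.empty_continuous_imp_countably_additive[OF pos])
    show "additive (sets M) ?l"
      using add nonneg by (auto simp: additive_def ennreal_plus[symmetric] simp del: ennreal_plus)
    show "\<forall>A\<in>sets M. ennreal (l A) \<noteq> \<infinity>" by simp
    fix A :: "nat \<Rightarrow> 'a set" assume A: "range A \<subseteq> sets M" "decseq A" "(\<Inter>i. A i) = {}"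
    have "(\<lambda>i. l (A i)) \<longlonglongrightarrow> 0"
    proof (rule LIMSEQ_I)
      fix r :: real assume r: "0 < r"
      obtain n where n: "\<bar>e n\<bar> < r / 2"
        using LIMSEQ_D[OF e, of "r / 2"] r by auto
      have "(\<lambda>i. measure (\<mu> n) (A i)) \<longlonglongrightarrow> measure (\<mu> n) (\<Inter>i. A i)"
        using A \<mu>(2) by (intro finite_measure.finite_Lim_measure_decseq[OF fin]) auto
      then have "(\<lambda>i. measure (\<mu> n) (A i)) \<longlonglongrightarrow> 0" using A(3) by simp
      from LIMSEQ_D[OF this, of "r / 2"] r obtain N where N: "\<And>i. N \<le> i \<Longrightarrow> measure (\<mu> n) (A i) < r / 2"
        by auto
      have "norm (l (A i) - 0) < r" if "N \<le> i" for i
        using near[of "A i" n] nonneg[of "A i"] A(1) N[OF that] n by (auto simp: abs_le_iff)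
      then show "\<exists>N. \<forall>i\<ge>N. norm (l (A i) - 0) < r" by blast
    qed
    then have "(\<lambda>i. ennreal (l (A i))) \<longlonglongrightarrow> ennreal 0" by (rule tendsto_ennrealI)
    then show "(\<lambda>i. ennreal (l (A i))) \<longlonglongrightarrow> 0" by simp
  qed
  let ?\<pi> = "measure_of (space M) (sets M) ?l"
  have em: "emeasure ?\<pi> B = ?l B" if "B \<in> sets M" for B
    by (rule emeasure_measure_of_sigma[OF sets.sigma_algebra_axioms pos ca that])
  show thesis
  proof
    show "prob_space ?\<pi>"
      by (rule prob_spaceI) (use em[of "space M"] total in simp)
    show "sets ?\<pi> = sets M" by simp
    show "measure ?\<pi> B = l B" if "B \<in> sets M" for B
      using em[OF that] nonneg[OF that] by (simp add: measure_def)
  qed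
qed

lemma eq_if_close:
  fixes a b :: real
  assumes "\<And>n. 0 < (n::nat) \<Longrightarrow> \<bar>a - b\<bar> \<le> c / n"
  shows "a = b"
proof -
  have "(\<lambda>n. c / real (Suc n)) \<longlonglongrightarrow> 0"
    by (intro LIMSEQ_Suc lim_const_over_n)
  then have "\<bar>a - b\<bar> \<le> 0"
    by (rule LIMSEQ_le_const) (use assms[of "Suc n" for n] in auto)
  then show ?thesis by simp
qed

section \<open>The one-step Markov property\<close>

lemma sets_chain_law [measurable_cong]:
  assumes K: "markov_kernel K"
  shows "sets (chain_law K x) = sets (PiM UNIV (\<lambda>_. borel))"
proof -
  interpret IT: Ionescu_Tulcea "chain_step K x" "\<lambda>_. borel"
    by (rule Ionescu_Tulcea_chain_step[OF K])
  show ?thesis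
    by (simp add: chain_law_def)
qed

lemma restrict_measurable_chain_law:
  fixes K :: "'a::topological_space \<Rightarrow> 'a measure"
  assumes K: "markov_kernel K"
  shows "(\<lambda>\<omega>. restrict \<omega> {0..<n}) \<in> chain_law K x \<rightarrow>\<^sub>M PiM {0..<n} (\<lambda>_. borel)"
  using measurable_restrict_subset[of "{0..<n}" UNIV "\<lambda>_. borel :: 'a measure"]
  by (simp add: measurable_cong_sets[OF sets_chain_law[OF K] refl])

text \<open>The marginal on the empty index set is a probability on a one-point space, and the
  cylinder over that point is the whole path space.\<close>

lemma prob_space_chain_law:
  assumes K: "markov_kernel K"
  shows "prob_space (chain_law K x)"
proof -
  interpret IT: Ionescu_Tulcea "chain_step K x" "\<lambda>_. borel"
    by (rule Ionescu_Tulcea_chain_step[OF K])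
  have "emeasure IT.PF.lim (IT.PF.emb UNIV {} {\<lambda>_. undefined}) = emeasure (IT.CI {}) {\<lambda>_. undefined}"
    by (rule IT.lim) (auto simp: sets_PiM_empty)
  moreover have "prob_space (IT.CI {})"
    by (rule IT.PF.prob_space_P) auto
  moreover have "space (IT.CI {}) = {\<lambda>_. undefined}"
    by (subst IT.PF.space_P) (auto simp: space_PiM_empty)
  moreover have "IT.PF.emb UNIV {} {\<lambda>_. undefined} = space IT.PF.lim"
    by (auto simp: prod_emb_def space_PiM restrict_def)
  ultimately show ?thesis
    by (auto intro!: prob_spaceI simp: chain_law_def dest!: prob_space.emeasure_space_1)
qed

text \<open>Cylinders over {0..<n} connect the projective limit with the n-fold composition of
  kernels, which starts in the only point of the empty product,
  \<open>\<lambda>_. undefined\<close>.\<close>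

lemma distr_restrict_chain_law:
  assumes K: "markov_kernel K"
  shows "distr (chain_law K x) (PiM {0..<n} (\<lambda>_. borel)) (\<lambda>\<omega>. restrict \<omega> {0..<n})
    = Ionescu_Tulcea.C (chain_step K x) (\<lambda>_. borel) 0 n (\<lambda>_. undefined)"
proof -
  interpret IT: Ionescu_Tulcea "chain_step K x" "\<lambda>_. borel"
    by (rule Ionescu_Tulcea_chain_step[OF K])
  have sC: "sets (IT.C 0 n (\<lambda>_. undefined)) = sets (PiM {0..<n} (\<lambda>_. borel))"
    by (subst IT.sets_C) (auto simp: space_PiM)
  show ?thesis
  proof (rule measure_eqI)
    fix A assume "A \<in> sets (distr (chain_law K x) (PiM {0..<n} (\<lambda>_. borel)) (\<lambda>\<omega>. restrict \<omega> {0..<n}))"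
    then have A: "A \<in> sets (PiM {0..<n} (\<lambda>_. borel))" by simp
    have "emeasure (distr (chain_law K x) (PiM {0..<n} (\<lambda>_. borel)) (\<lambda>\<omega>. restrict \<omega> {0..<n})) A
      = emeasure (chain_law K x) (IT.PF.emb UNIV {0..<n} A)"
      by (rule emeasure_distr_restrict) (use A sets_chain_law[OF K] in auto)
    also have "\<dots> = emeasure (IT.CI {0..<n}) A"
      unfolding chain_law_def using A by (intro IT.lim) auto
    also have "\<dots> = IT.C 0 n (\<lambda>_. undefined) (IT.PF.emb {0..<n} {0..<n} A)"
      by (rule IT.emeasure_CI) (use A in auto)
    also have "IT.PF.emb {0..<n} {0..<n} A = A"
      using A by (intro prod_emb_id) (use sets.sets_into_space[OF A] in \<open>auto simp: space_PiM\<close>)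
    finally show "emeasure (distr (chain_law K x) (PiM {0..<n} (\<lambda>_. borel)) (\<lambda>\<omega>. restrict \<omega> {0..<n})) A
      = emeasure (IT.C 0 n (\<lambda>_. undefined)) A" .
  qed (simp add: sC)
qed

lemma markov_kernelD:
  assumes "markov_kernel K"
  shows "prob_space (K y)" "sets (K y) = sets borel" "space (K y) = UNIV"
  using measurable_space[OF assms, of y] sets_eq_imp_space_eq[of "K y" borel]
  by (auto simp add: space_prob_algebra)

text \<open>Testing against functions \<open>h\<close> of the times 0 to k replaces conditioning on
  a filtration. On finite products the law up to time k + 1 is one \<open>bind\<close> of the law up
  to time k, so the claim reduces to integrating out the last coordinate.\<close>

lemma nn_integral_chain_law_step:
  assumes K: "markov_kernel K"
    and h: "h \<in> borel_measurable (PiM {0..<Suc k} (\<lambda>_. borel))"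
    and \<phi>: "\<phi> \<in> borel_measurable borel"
  shows "(\<integral>\<^sup>+\<omega>. h (restrict \<omega> {0..<Suc k}) * \<phi> (\<omega> (Suc k)) \<partial>chain_law K x)
    = (\<integral>\<^sup>+\<omega>. h (restrict \<omega> {0..<Suc k}) * (\<integral>\<^sup>+y. \<phi> y \<partial>K (\<omega> k)) \<partial>chain_law K x)"
proof -
  interpret IT: Ionescu_Tulcea "chain_step K x" "\<lambda>_. borel"
    by (rule Ionescu_Tulcea_chain_step[OF K])
  note h[measurable] \<phi>[measurable]
  have [measurable]: "K \<in> borel \<rightarrow>\<^sub>M subprob_algebra borel"
    using K by (rule measurable_prob_algebraD)
  let ?M = "\<lambda>n::nat. PiM {0..<n} (\<lambda>_. borel :: 'a measure)"
  let ?u = "\<lambda>_::nat. undefined :: 'a"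
  note r = restrict_measurable_chain_law[OF K]
  define F where "F \<omega> = h (restrict \<omega> {0..<Suc k}) * \<phi> (\<omega> (Suc k))" for \<omega>
  define G where "G \<omega> = h \<omega> * (\<integral>\<^sup>+y. \<phi> y \<partial>K (\<omega> k))" for \<omega>
  have rM: "(\<lambda>\<omega>. restrict \<omega> {0..<Suc k}) \<in> ?M (Suc (Suc k)) \<rightarrow>\<^sub>M ?M (Suc k)"
    by (rule measurable_restrict_subset) auto
  have F[measurable]: "F \<in> borel_measurable (?M (Suc (Suc k)))"
    unfolding F_def
    by (intro borel_measurable_times_ennreal measurable_compose[OF rM h]
        measurable_compose[OF measurable_component_singleton[of "Suc k"] \<phi>]) auto
  have G[measurable]: "G \<in> borel_measurable (?M (Suc k))"
    unfolding G_def
    by (intro borel_measurable_times_ennreal h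
        measurable_compose[OF measurable_component_singleton[of k]
          measurable_compose[OF \<open>K \<in> borel \<rightarrow>\<^sub>M subprob_algebra borel\<close>
            nn_integral_measurable_subprob_algebra[OF \<phi>]]]) auto
  have u0: "?u \<in> space (?M 0)" by (simp add: space_PiM)
  have "(\<integral>\<^sup>+\<omega>. h (restrict \<omega> {0..<Suc k}) * \<phi> (\<omega> (Suc k)) \<partial>chain_law K x)
    = (\<integral>\<^sup>+\<omega>. F (restrict \<omega> {0..<Suc (Suc k)}) \<partial>chain_law K x)"
    unfolding F_def by (intro nn_integral_cong) (auto simp: Int_absorb1)
  also have "\<dots> = (\<integral>\<^sup>+\<omega>. F \<omega> \<partial>distr (chain_law K x) (?M (Suc (Suc k))) (\<lambda>\<omega>. restrict \<omega> {0..<Suc (Suc k)}))"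
    by (rule nn_integral_distr[symmetric, OF r]) (use F in simp)
  also have "\<dots> = (\<integral>\<^sup>+\<omega>. F \<omega> \<partial>(IT.C 0 (Suc k) ?u \<bind> IT.eP (Suc k)))"
    by (subst distr_restrict_chain_law[OF K]) simp
  also have "\<dots> = (\<integral>\<^sup>+\<omega>. (\<integral>\<^sup>+\<eta>. F \<eta> \<partial>IT.eP (Suc k) \<omega>) \<partial>IT.C 0 (Suc k) ?u)"
  proof (rule nn_integral_bind[OF F])
    have "sets (IT.C 0 (Suc k) ?u) = sets (?M (Suc k))"
      using IT.sets_C[OF u0, of "Suc k"] by simp
    from measurable_cong_sets[OF this refl] IT.measurable_eP[of "Suc k"]
    show "IT.eP (Suc k) \<in> IT.C 0 (Suc k) ?u \<rightarrow>\<^sub>M subprob_algebra (?M (Suc (Suc k)))"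
      by blast
  qed
  also have "\<dots> = (\<integral>\<^sup>+\<omega>. G \<omega> \<partial>IT.C 0 (Suc k) ?u)"
  proof (intro nn_integral_cong)
    fix \<omega> assume "\<omega> \<in> space (IT.C 0 (Suc k) ?u)"
    then have \<omega>: "\<omega> \<in> space (?M (Suc k))"
      using IT.space_C[OF u0, of "Suc k"] by (simp del: IT.C.simps)
    \<comment> \<open>Points of the product space are extensional, so cutting off the appended
      coordinate returns \<open>\<omega>\<close> itself.\<close>
    have h_eq: "restrict (fun_upd \<omega> (Suc k) y) {0..<Suc k} = \<omega>" for y
      using \<omega> by (auto simp: space_PiM restrict_def PiE_def extensional_def fun_eq_iff)
    have "(\<integral>\<^sup>+\<eta>. F \<eta> \<partial>IT.eP (Suc k) \<omega>) = (\<integral>\<^sup>+y. h \<omega> * \<phi> y \<partial>K (\<omega> k))"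
      by (subst IT.nn_integral_eP[OF \<omega> F]) (simp only: F_def h_eq fun_upd_same chain_step_def nat.case)
    also have "\<dots> = G \<omega>"
      unfolding G_def using \<phi>
      by (intro nn_integral_cmult) (simp add: measurable_cong_sets[OF markov_kernelD(2)[OF K] refl])
    finally show "(\<integral>\<^sup>+\<eta>. F \<eta> \<partial>IT.eP (Suc k) \<omega>) = G \<omega>" .
  qed
  also have "\<dots> = (\<integral>\<^sup>+\<omega>. G \<omega> \<partial>distr (chain_law K x) (?M (Suc k)) (\<lambda>\<omega>. restrict \<omega> {0..<Suc k}))"
    by (subst distr_restrict_chain_law[OF K]) simp
  also have "\<dots> = (\<integral>\<^sup>+\<omega>. G (restrict \<omega> {0..<Suc k}) \<partial>chain_law K x)"
    by (rule nn_integral_distr[OF r]) (use G in simp)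
  also have "\<dots> = (\<integral>\<^sup>+\<omega>. h (restrict \<omega> {0..<Suc k}) * (\<integral>\<^sup>+y. \<phi> y \<partial>K (\<omega> k)) \<partial>chain_law K x)"
    unfolding G_def by (intro nn_integral_cong) auto
  finally show ?thesis .
qed

lemma AE_chain_law_0:
  fixes K :: "'a::t1_space \<Rightarrow> 'a measure"
  assumes K: "markov_kernel K"
  shows "AE \<omega> in chain_law K x. \<omega> 0 = x"
proof -
  interpret IT: Ionescu_Tulcea "chain_step K x" "\<lambda>_. borel"
    by (rule Ionescu_Tulcea_chain_step[OF K])
  let ?M = "\<lambda>n::nat. PiM {0..<n} (\<lambda>_. borel :: 'a measure)"
  let ?u = "\<lambda>_::nat. undefined :: 'a"
  note r = restrict_measurable_chain_law[OF K]
  have u0: "?u \<in> space (?M 0)" by (simp add: space_PiM)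
  have "IT.C 0 1 ?u = return (?M 0) ?u \<bind> IT.eP 0"
    by simp
  also have "\<dots> = IT.eP 0 ?u"
    by (rule bind_return[OF IT.measurable_eP u0])
  finally have C: "IT.C 0 1 ?u = IT.eP 0 ?u" .
  then have eq: "distr (chain_law K x) (?M 1) (\<lambda>\<omega>. restrict \<omega> {0..<1}) = distr (return borel x) (?M 1) (fun_upd ?u 0)"
    unfolding distr_restrict_chain_law[OF K] C by (simp add: IT.eP_def chain_step_def)
  \<comment> \<open>Singletons are Borel because points are closed in a
    \<open>t1_space\<close>.\<close>
  have "Measurable.pred borel (\<lambda>y. y = x)"
    by (simp add: pred_def)
  moreover have "(\<lambda>\<omega>. \<omega> 0) \<in> ?M 1 \<rightarrow>\<^sub>M borel"
    by (rule measurable_component_singleton) simp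
  ultimately have m: "Measurable.pred (?M 1) (\<lambda>\<omega>. \<omega> 0 = x)"
    by (rule measurable_compose[rotated])
  have f: "fun_upd ?u 0 \<in> borel \<rightarrow>\<^sub>M ?M 1"
    by (rule measurable_fun_upd[where J="{}"]) auto
  have "AE \<omega> in distr (return borel x) (?M 1) (fun_upd ?u 0). \<omega> 0 = x"
    using f m by (subst AE_distr_iff) (auto simp: AE_return pred_def)
  then have "AE \<omega> in distr (chain_law K x) (?M 1) (\<lambda>\<omega>. restrict \<omega> {0..<1}). \<omega> 0 = x"
    by (simp only: eq)
  then show ?thesis
    by (subst (asm) AE_distr_iff) (use r[of 1] m in \<open>auto simp: pred_def\<close>)
qed

section \<open>The transition operator on bounded functions\<close>

locale markov_chain =
  fixes K :: "'a::t1_space \<Rightarrow> 'a measure"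
  assumes K: "markov_kernel K"
begin

abbreviation "law \<equiv> chain_law K"

sublocale kernel: prob_space "K x" for x
  using markov_kernelD[OF K] by simp

sublocale law: prob_space "law x" for x
  by (rule prob_space_chain_law[OF K])

lemmas sets_kernel [simp, measurable_cong] = markov_kernelD(2)[OF K]
lemmas space_kernel [simp] = markov_kernelD(3)[OF K]
lemmas sets_law [measurable_cong] = sets_chain_law[OF K]

lemma space_law [simp]: "space (law x) = UNIV"
  using sets_eq_imp_space_eq[OF sets_law[of x]] by (simp add: space_PiM)

lemma coordinate_measurable [measurable (raw)]: "(\<lambda>\<omega>. \<omega> i) \<in> law x \<rightarrow>\<^sub>M borel"
  using measurable_component_singleton[of i UNIV "\<lambda>_. borel"]
  by (simp add: measurable_cong_sets[OF sets_law refl])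

lemma kernel_subprob [measurable]: "K \<in> borel \<rightarrow>\<^sub>M subprob_algebra borel"
  using K by (rule measurable_prob_algebraD)

definition trans_op :: "('a \<Rightarrow> real) \<Rightarrow> 'a \<Rightarrow> real" where
  "trans_op \<phi> x = (\<integral>y. \<phi> y \<partial>K x)"

lemma trans_op_measurable [measurable (raw)]:
  assumes "\<phi> \<in> borel_measurable borel"
  shows "(\<lambda>x. trans_op \<phi> x) \<in> borel_measurable borel"
  unfolding trans_op_def[abs_def] using assms
  by (intro measurable_compose[OF kernel_subprob integral_measurable_subprob_algebra]) auto

lemma kernel_integrable:
  fixes \<phi> :: "'a \<Rightarrow> real"
  assumes "\<phi> \<in> borel_measurable borel" "\<And>x. \<bar>\<phi> x\<bar> \<le> b"
  shows "integrable (K x) \<phi>"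
  using assms by (intro kernel.integrable_bounded[of _ x b]) auto

lemma trans_op_bound:
  assumes "\<phi> \<in> borel_measurable borel" "\<And>x. \<bar>\<phi> x\<bar> \<le> b"
  shows "\<bar>trans_op \<phi> x\<bar> \<le> b"
  unfolding trans_op_def using assms by (intro kernel.abs_expectation_le) auto

lemma integral_law_step_nonneg:
  assumes E: "Measurable.pred (PiM {0..<Suc k} (\<lambda>_. borel)) E" "\<And>\<omega>. E (restrict \<omega> {0..<Suc k}) = E \<omega>"
    and \<phi>: "\<phi> \<in> borel_measurable borel" "\<And>x. 0 \<le> \<phi> x" "\<And>x. \<phi> x \<le> b"
  shows "(\<integral>\<omega>. (if E \<omega> then \<phi> (\<omega> (Suc k)) else 0) \<partial>law x)
    = (\<integral>\<omega>. (if E \<omega> then trans_op \<phi> (\<omega> k) else 0) \<partial>law x)"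
proof -
  have [measurable]: "Measurable.pred (law x) E"
    using measurable_compose[OF restrict_measurable_chain_law[OF K] E(1)] by (simp add: E(2))
  note \<phi>(1)[measurable]
  have tm[measurable]: "trans_op \<phi> \<in> borel_measurable borel"
    using trans_op_measurable[OF \<phi>(1)] .
  have tb: "0 \<le> trans_op \<phi> y" for y
    unfolding trans_op_def using \<phi>(2) by simp
  have tn: "ennreal (trans_op \<phi> y) = (\<integral>\<^sup>+z. ennreal (\<phi> z) \<partial>K y)" for y
    unfolding trans_op_def using \<phi>
    by (intro nn_integral_eq_integral[symmetric] kernel_integrable[of \<phi> b]) auto
  define h where "h \<omega> = (if E \<omega> then 1 else 0 :: ennreal)" for \<omega>
  have h: "h \<in> borel_measurable (PiM {0..<Suc k} (\<lambda>_. borel))"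
    unfolding h_def using E(1) by measurable
  have "(\<integral>\<^sup>+\<omega>. ennreal (if E \<omega> then \<phi> (\<omega> (Suc k)) else 0) \<partial>law x)
    = (\<integral>\<^sup>+\<omega>. h (restrict \<omega> {0..<Suc k}) * ennreal (\<phi> (\<omega> (Suc k))) \<partial>law x)"
    by (intro nn_integral_cong) (simp add: h_def E(2))
  also have "\<dots> = (\<integral>\<^sup>+\<omega>. h (restrict \<omega> {0..<Suc k}) * (\<integral>\<^sup>+y. ennreal (\<phi> y) \<partial>K (\<omega> k)) \<partial>law x)"
    by (rule nn_integral_chain_law_step[OF K h]) simp
  also have "\<dots> = (\<integral>\<^sup>+\<omega>. ennreal (if E \<omega> then trans_op \<phi> (\<omega> k) else 0) \<partial>law x)"
    by (intro nn_integral_cong) (simp add: h_def E(2) tn)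
  finally show ?thesis
    using \<phi>(2) tb by (subst (1 2) integral_eq_nn_integral) (auto intro!: measurable_If)
qed

text \<open>Adding \<open>b\<close> makes \<open>\<phi>\<close> nonnegative; since the operator
  fixes constants, both sides grow by \<open>b\<close> times the probability of
  \<open>E\<close>.\<close>

lemma integral_law_step:
  assumes E: "Measurable.pred (PiM {0..<Suc k} (\<lambda>_. borel)) E" "\<And>\<omega>. E (restrict \<omega> {0..<Suc k}) = E \<omega>"
    and \<phi>: "\<phi> \<in> borel_measurable borel" "\<And>x. \<bar>\<phi> x\<bar> \<le> b"
  shows "(\<integral>\<omega>. (if E \<omega> then \<phi> (\<omega> (Suc k)) else 0) \<partial>law x)
    = (\<integral>\<omega>. (if E \<omega> then trans_op \<phi> (\<omega> k) else 0) \<partial>law x)"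
proof -
  have [measurable]: "Measurable.pred (law x) E"
    using measurable_compose[OF restrict_measurable_chain_law[OF K] E(1)] by (simp add: E(2))
  note \<phi>(1)[measurable]
  have b0: "0 \<le> b" using \<phi>(2)[of undefined] by simp
  have tm[measurable]: "trans_op \<phi> \<in> borel_measurable borel"
    using trans_op_measurable[OF \<phi>(1)] .
  have tb: "\<bar>trans_op \<phi> y\<bar> \<le> b" for y by (rule trans_op_bound[OF \<phi>])
  have t: "trans_op (\<lambda>y. \<phi> y + b) y = trans_op \<phi> y + b" for y
    unfolding trans_op_def using kernel_integrable[OF \<phi>]
    by (simp add: kernel.prob_space[simplified])
  have eq: "(\<integral>\<omega>. (if E \<omega> then \<phi> (\<omega> (Suc k)) + b else 0) \<partial>law x)
    = (\<integral>\<omega>. (if E \<omega> then trans_op (\<lambda>y. \<phi> y + b) (\<omega> k) else 0) \<partial>law x)"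
  proof (rule integral_law_step_nonneg[OF E, of _ "2 * b"])
    show "0 \<le> \<phi> y + b" "\<phi> y + b \<le> 2 * b" for y
      using \<phi>(2)[of y] by auto
  qed (use \<phi>(1) in simp)
  have i: "integrable (law x) (\<lambda>\<omega>. if E \<omega> then \<phi> (\<omega> (Suc k)) else 0)"
    "integrable (law x) (\<lambda>\<omega>. if E \<omega> then trans_op \<phi> (\<omega> k) else 0)"
    "integrable (law x) (\<lambda>\<omega>. if E \<omega> then b else 0)"
    using \<phi>(2) tb b0 by (auto intro!: law.integrable_bounded[of _ _ b])
  have "(\<integral>\<omega>. (if E \<omega> then \<phi> (\<omega> (Suc k)) + b else 0) \<partial>law x)
    = (\<integral>\<omega>. (if E \<omega> then \<phi> (\<omega> (Suc k)) else 0) + (if E \<omega> then b else 0) \<partial>law x)"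
    by (intro Bochner_Integration.integral_cong) auto
  moreover have "(\<integral>\<omega>. (if E \<omega> then trans_op (\<lambda>y. \<phi> y + b) (\<omega> k) else 0) \<partial>law x)
    = (\<integral>\<omega>. (if E \<omega> then trans_op \<phi> (\<omega> k) else 0) + (if E \<omega> then b else 0) \<partial>law x)"
    by (intro Bochner_Integration.integral_cong) (auto simp: t)
  ultimately show ?thesis using eq i by simp
qed

end

section \<open>Dynkin's formula\<close>

text \<open>\<open>Q k\<close> is a stop signal at time k, and the stopping time is
  \<open>LEAST s. Q s \<omega>\<close>. Signals are predicates on full paths; invariance under
  restriction to {0..<Suc k} says that they depend on the times 0 to k only.\<close>

definition adapted :: "(nat \<Rightarrow> (nat \<Rightarrow> 'a::topological_space) \<Rightarrow> bool) \<Rightarrow> bool" where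
  "adapted Q \<longleftrightarrow> (\<forall>k. Measurable.pred (PiM {0..<Suc k} (\<lambda>_. borel)) (Q k) \<and>
     (\<forall>\<omega>. Q k (restrict \<omega> {0..<Suc k}) = Q k \<omega>))"

text \<open>That no signal has occurred up to time k is known at time k, so this event can serve as
  \<open>E\<close> in \<open>integral_law_step\<close> for the transition from k to k + 1.\<close>

lemma adapted_all_not:
  fixes Q :: "nat \<Rightarrow> (nat \<Rightarrow> 'a::topological_space) \<Rightarrow> bool"
  assumes "adapted Q"
  shows "Measurable.pred (PiM {0..<Suc k} (\<lambda>_. borel)) (\<lambda>\<omega>. \<forall>s\<le>k. \<not> Q s \<omega>)"
    "(\<forall>s\<le>k. \<not> Q s (restrict \<omega> {0..<Suc k})) \<longleftrightarrow> (\<forall>s\<le>k. \<not> Q s \<omega>)"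
proof -
  have Q: "Measurable.pred (PiM {0..<Suc s} (\<lambda>_. borel)) (Q s)"
    "Q s (restrict \<omega> {0..<Suc s}) = Q s \<omega>" for s \<omega>
    using assms by (auto simp: adapted_def)
  have "Measurable.pred (PiM {0..<Suc k} (\<lambda>_. borel)) (Q s)" if "s \<le> k" for s
  proof -
    have "(\<lambda>\<omega>. restrict \<omega> {0..<Suc s}) \<in> PiM {0..<Suc k} (\<lambda>_. borel :: 'a measure) \<rightarrow>\<^sub>M PiM {0..<Suc s} (\<lambda>_. borel)"
      using that by (intro measurable_restrict_subset) auto
    from measurable_compose[OF this Q(1)] show ?thesis by (simp only: Q(2))
  qed
  then have "Measurable.pred (PiM {0..<Suc k} (\<lambda>_. borel)) (\<lambda>\<omega>. \<forall>s\<in>{..k}. \<not> Q s \<omega>)"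
    by (intro pred_intros_finite(3) pred_intros_logic(2)) (simp_all only: finite_atMost atMost_iff)
  then show "Measurable.pred (PiM {0..<Suc k} (\<lambda>_. borel)) (\<lambda>\<omega>. \<forall>s\<le>k. \<not> Q s \<omega>)"
    by (simp only: Ball_def atMost_iff)
  have "Q s (restrict \<omega> {0..<Suc k}) = Q s \<omega>" if "s \<le> k" for s
  proof -
    have "restrict (restrict \<omega> {0..<Suc k}) {0..<Suc s} = restrict \<omega> {0..<Suc s}"
      using that by (auto simp: fun_eq_iff)
    then show ?thesis by (metis Q(2))
  qed
  then show "(\<forall>s\<le>k. \<not> Q s (restrict \<omega> {0..<Suc k})) \<longleftrightarrow> (\<forall>s\<le>k. \<not> Q s \<omega>)"
    by auto
qed

context markov_chain
begin

lemma adapted_measurable: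
  assumes "adapted Q"
  shows "Measurable.pred (law x) (Q s)"
proof -
  have Q: "Measurable.pred (PiM {0..<Suc s} (\<lambda>_. borel)) (Q s)" "\<And>\<omega>. Q s (restrict \<omega> {0..<Suc s}) = Q s \<omega>"
    using assms by (auto simp: adapted_def)
  from measurable_compose[OF restrict_measurable_chain_law[OF K, of "Suc s" x] Q(1)] show ?thesis
    by (simp only: Q(2))
qed

lemma funpow_trans_op:
  assumes "\<phi> \<in> borel_measurable borel" "\<And>x. \<bar>\<phi> x\<bar> \<le> b"
  shows "(trans_op ^^ i) \<phi> \<in> borel_measurable borel" "\<bar>(trans_op ^^ i) \<phi> x\<bar> \<le> b"
proof -
  have "(trans_op ^^ i) \<phi> \<in> borel_measurable borel \<and> (\<forall>x. \<bar>(trans_op ^^ i) \<phi> x\<bar> \<le> b)"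
    by (induction i) (use assms trans_op_measurable trans_op_bound in auto)
  then show "(trans_op ^^ i) \<phi> \<in> borel_measurable borel" "\<bar>(trans_op ^^ i) \<phi> x\<bar> \<le> b" by auto
qed

lemma integral_law_coordinate:
  assumes "\<phi> \<in> borel_measurable borel" "\<And>x. \<bar>\<phi> x\<bar> \<le> b"
  shows "(\<integral>\<omega>. \<phi> (\<omega> i) \<partial>law x) = (trans_op ^^ i) \<phi> x"
  using assms
proof (induction i arbitrary: \<phi>)
  case 0
  note 0(1)[measurable]
  have "(\<integral>\<omega>. \<phi> (\<omega> 0) \<partial>law x) = (\<integral>\<omega>. \<phi> x \<partial>law x)"
    using AE_chain_law_0[OF K, of x] by (intro integral_cong_AE) auto
  then show ?case by (simp add: law.prob_space[simplified])
next
  case (Suc i)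
  have "(\<integral>\<omega>. \<phi> (\<omega> (Suc i)) \<partial>law x) = (\<integral>\<omega>. trans_op \<phi> (\<omega> i) \<partial>law x)"
    using integral_law_step[where k = i and E = "\<lambda>_. True" and x = x, OF _ _ Suc.prems] by simp
  also have "\<dots> = (trans_op ^^ i) (trans_op \<phi>) x"
    using Suc.prems by (intro Suc.IH trans_op_measurable trans_op_bound)
  finally show ?case by (simp add: funpow_swap1)
qed

text \<open>The hypothesis on \<open>T\<close> bounds the expected stopping time, written as the sum
  of its tails. The estimate telescopes over truncated stopping times: passing from k to k + 1
  changes the value only where no signal has occurred up to k, and there the Markov property turns
  the expected increment into that of \<open>trans_op \<phi> - \<phi>\<close>.\<close>

lemma dynkin_bound:
  assumes Q: "adapted Q"
    and \<phi>: "\<phi> \<in> borel_measurable borel" "\<And>x. \<bar>\<phi> x\<bar> \<le> b"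
    and \<delta>: "\<And>y. \<bar>trans_op \<phi> y - \<phi> y\<bar> \<le> \<delta>"
    and T: "\<And>k. (\<Sum>j<k. measure (law x) {\<omega>. \<forall>s\<le>j. \<not> Q s \<omega>}) \<le> T"
  shows "AE \<omega> in law x. \<exists>s. Q s \<omega>"
    and "\<bar>(\<integral>\<omega>. \<phi> (\<omega> (LEAST s. Q s \<omega>)) \<partial>law x) - \<phi> x\<bar> \<le> \<delta> * T"
proof -
  note [measurable] = adapted_measurable[OF Q] \<phi>(1) trans_op_measurable[OF \<phi>(1)]
  have \<delta>0: "0 \<le> \<delta>" using \<delta>[of x] by simp
  define E where "E k \<omega> \<longleftrightarrow> (\<forall>s\<le>k. \<not> Q s \<omega>)" for k \<omega>
  have E_meas[measurable]: "Measurable.pred (law x) (E k)" for k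
    unfolding E_def by measurable
  have E_sets: "{\<omega>. E k \<omega>} \<in> sets (law x)" for k
    using E_meas[of k] by (simp add: pred_def)
  have fin: "measure (law x) {\<omega>. \<forall>s. \<not> Q s \<omega>} = 0"
  proof (rule ccontr)
    define p where "p = measure (law x) {\<omega>. \<forall>s. \<not> Q s \<omega>}"
    assume "p \<noteq> 0"
    then have "0 < p" unfolding p_def by (simp add: zero_less_measure_iff)
    then obtain k where k: "T < real k * p" using reals_Archimedean3 by blast
    \<comment> \<open>Each tail is at least the probability \<open>p\<close> that no signal ever
      occurs, so k tails sum to at least k * p.\<close>
    have "p \<le> measure (law x) {\<omega>. \<forall>s\<le>j. \<not> Q s \<omega>}" for j
      unfolding p_def using E_sets[of j] by (intro law.finite_measure_mono) (auto simp: E_def)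
    then have "(\<Sum>j<k. p) \<le> T"
      by (intro order_trans[OF sum_mono T])
    then show False using k by simp
  qed
  show AE: "AE \<omega> in law x. \<exists>s. Q s \<omega>"
  proof (subst AE_iff_measurable[OF _ refl])
    have "Measurable.pred (law x) (\<lambda>\<omega>. \<forall>s. \<not> Q s \<omega>)" by measurable
    then show "{\<omega> \<in> space (law x). \<not> (\<exists>s. Q s \<omega>)} \<in> sets (law x)" by (simp add: pred_def)
    show "emeasure (law x) {\<omega> \<in> space (law x). \<not> (\<exists>s. Q s \<omega>)} = 0"
      using fin by (simp add: law.emeasure_eq_measure)
  qed
  \<comment> \<open>The stopping time truncated at \<open>k\<close>.\<close>
  define N where "N k \<omega> = (LEAST s. Q s \<omega> \<or> s = k)" for k \<omega>
  have N_meas[measurable]: "N k \<in> law x \<rightarrow>\<^sub>M count_space UNIV" for k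
    unfolding N_def by (intro measurable_Least) measurable
  have coord: "(\<lambda>\<omega>. \<phi> (\<omega> (n \<omega>))) \<in> borel_measurable (law x)"
    if "n \<in> law x \<rightarrow>\<^sub>M count_space UNIV" for n
    using \<phi>(1) that
    by (intro measurable_compose_countable[where f = "\<lambda>i \<omega>. \<phi> (\<omega> i)" and g = n]) auto
  have iN: "integrable (law x) (\<lambda>\<omega>. \<phi> (\<omega> (N k \<omega>)))" for k
    using coord[OF N_meas] \<phi>(2) by (intro law.integrable_bounded[of _ _ b])
  \<comment> \<open>Only times s < k are excluded, since a signal at k itself gives the value k as
    well. The event \<open>E k\<close> also excludes k, which gives
    \<open>N (Suc k) \<omega> = Suc k\<close> on it.\<close>
  have N_alive: "N k \<omega> = k" if "\<forall>s<k. \<not> Q s \<omega>" for k \<omega>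
    unfolding N_def using that by (intro Least_equality) (auto simp: not_less[symmetric])
  have N_dead: "N k \<omega> = (LEAST s. Q s \<omega>)" if "Q s \<omega>" "s \<le> k" for s k \<omega>
  proof -
    have "(LEAST s. Q s \<omega>) \<le> k" using Least_le[of "\<lambda>s. Q s \<omega>", OF that(1)] that(2) by simp
    then show ?thesis
      unfolding N_def using LeastI[of "\<lambda>s. Q s \<omega>", OF that(1)]
      by (intro Least_equality) (auto intro: Least_le)
  qed
  have step: "\<bar>(\<integral>\<omega>. \<phi> (\<omega> (N (Suc k) \<omega>)) \<partial>law x) - (\<integral>\<omega>. \<phi> (\<omega> (N k \<omega>)) \<partial>law x)\<bar>
      \<le> \<delta> * measure (law x) {\<omega>. E k \<omega>}" for k
  proof -
    have diff: "\<phi> (\<omega> (N (Suc k) \<omega>)) - \<phi> (\<omega> (N k \<omega>)) =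
        (if E k \<omega> then \<phi> (\<omega> (Suc k)) else 0) - (if E k \<omega> then \<phi> (\<omega> k) else 0)" for \<omega>
    proof (cases "E k \<omega>")
      case True
      then have "N (Suc k) \<omega> = Suc k" "N k \<omega> = k"
        by (auto intro!: N_alive simp: E_def)
      then show ?thesis using True by simp
    next
      case False
      then obtain s where "Q s \<omega>" "s \<le> k" by (auto simp: E_def)
      then have "N (Suc k) \<omega> = N k \<omega>" using N_dead[of s \<omega> k] N_dead[of s \<omega> "Suc k"] by simp
      then show ?thesis using False by simp
    qed
    have i1: "integrable (law x) (\<lambda>\<omega>. if E k \<omega> then f (\<omega> j) else 0)"
      if "f \<in> borel_measurable borel" "\<And>y. \<bar>f y\<bar> \<le> b" for f j
    proof -
      have "0 \<le> b" using that(2)[of x] by linarith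
      then show ?thesis using that by (intro law.integrable_bounded[of _ _ b]) auto
    qed
    note iK = i1[OF trans_op_measurable[OF \<phi>(1)] trans_op_bound[OF \<phi>]]
    have "(\<integral>\<omega>. \<phi> (\<omega> (N (Suc k) \<omega>)) \<partial>law x) - (\<integral>\<omega>. \<phi> (\<omega> (N k \<omega>)) \<partial>law x)
      = (\<integral>\<omega>. \<phi> (\<omega> (N (Suc k) \<omega>)) - \<phi> (\<omega> (N k \<omega>)) \<partial>law x)"
      using iN by simp
    also have "\<dots> = (\<integral>\<omega>. (if E k \<omega> then \<phi> (\<omega> (Suc k)) else 0) \<partial>law x) - (\<integral>\<omega>. (if E k \<omega> then \<phi> (\<omega> k) else 0) \<partial>law x)"
      unfolding diff using i1[OF \<phi>] by simp
    also have "(\<integral>\<omega>. (if E k \<omega> then \<phi> (\<omega> (Suc k)) else 0) \<partial>law x) = (\<integral>\<omega>. (if E k \<omega> then trans_op \<phi> (\<omega> k) else 0) \<partial>law x)"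
      using adapted_all_not[OF Q] unfolding E_def by (intro integral_law_step[OF _ _ \<phi>])
    also have "\<dots> - (\<integral>\<omega>. (if E k \<omega> then \<phi> (\<omega> k) else 0) \<partial>law x)
      = (\<integral>\<omega>. (if E k \<omega> then trans_op \<phi> (\<omega> k) else 0) - (if E k \<omega> then \<phi> (\<omega> k) else 0) \<partial>law x)"
      using i1[OF \<phi>] iK by simp
    also have "\<bar>\<dots>\<bar> \<le> (\<integral>\<omega>. \<bar>(if E k \<omega> then trans_op \<phi> (\<omega> k) else 0) - (if E k \<omega> then \<phi> (\<omega> k) else 0)\<bar> \<partial>law x)"
      by (rule integral_abs_bound)
    also have "\<dots> \<le> (\<integral>\<omega>. \<delta> * indicator {\<omega>. E k \<omega>} \<omega> \<partial>law x)"
    proof (rule integral_mono[OF integrable_abs[OF Bochner_Integration.integrable_diff[OF iK i1[OF \<phi>]]]])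
      show "integrable (law x) (\<lambda>\<omega>. \<delta> * indicator {\<omega>. E k \<omega>} \<omega>)"
        using E_sets by (intro integrable_mult_right integrable_real_indicator) (auto simp: less_top[symmetric])
      show "\<bar>(if E k \<omega> then trans_op \<phi> (\<omega> k) else 0) - (if E k \<omega> then \<phi> (\<omega> k) else 0)\<bar>
          \<le> \<delta> * indicator {\<omega>. E k \<omega>} \<omega>" for \<omega>
        using \<delta>[of "\<omega> k"] by simp
    qed
    also have "\<dots> = \<delta> * measure (law x) {\<omega>. E k \<omega>}"
      using E_sets by simp
    finally show ?thesis .
  qed
  have stopped: "\<bar>(\<integral>\<omega>. \<phi> (\<omega> (N k \<omega>)) \<partial>law x) - \<phi> x\<bar> \<le> \<delta> * (\<Sum>j<k. measure (law x) {\<omega>. E j \<omega>})" for k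
  proof (induction k)
    case 0
    have "N 0 \<omega> = 0" for \<omega> by (rule N_alive) simp
    then show ?case
      using integral_law_coordinate[OF \<phi>, where i = 0 and x = x] by simp
  next
    case (Suc k)
    then show ?case using step[of k] by (simp add: distrib_left)
  qed
  \<comment> \<open>Almost every path has a signal, after which the truncated time no longer depends
    on k; boundedness of \<open>\<phi>\<close> gives the domination.\<close>
  have "(\<lambda>k. \<integral>\<omega>. \<phi> (\<omega> (N k \<omega>)) \<partial>law x) \<longlonglongrightarrow> (\<integral>\<omega>. \<phi> (\<omega> (LEAST s. Q s \<omega>)) \<partial>law x)"
  proof (rule integral_dominated_convergence[where w = "\<lambda>_. b" and s = "\<lambda>k \<omega>. \<phi> (\<omega> (N k \<omega>))"
        and f = "\<lambda>\<omega>. \<phi> (\<omega> (LEAST s. Q s \<omega>))"])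
    show "AE \<omega> in law x. (\<lambda>k. \<phi> (\<omega> (N k \<omega>))) \<longlonglongrightarrow> \<phi> (\<omega> (LEAST s. Q s \<omega>))"
      using AE
    proof eventually_elim
      case (elim \<omega>)
      then obtain s where "Q s \<omega>" by auto
      then have "\<forall>\<^sub>F k in sequentially. \<phi> (\<omega> (N k \<omega>)) = \<phi> (\<omega> (LEAST s. Q s \<omega>))"
        by (intro eventually_sequentiallyI[of s]) (simp add: N_dead[of s])
      then show ?case by (rule tendsto_eventually)
    qed
    show "(\<lambda>\<omega>. \<phi> (\<omega> (LEAST s. Q s \<omega>))) \<in> borel_measurable (law x)"
      using adapted_measurable[OF Q] by (intro coord[of "\<lambda>\<omega>. LEAST s. Q s \<omega>"] measurable_Least)
    show "(\<lambda>\<omega>. \<phi> (\<omega> (N k \<omega>))) \<in> borel_measurable (law x)" for k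
      by (rule coord[OF N_meas])
    show "AE \<omega> in law x. norm (\<phi> (\<omega> (N k \<omega>))) \<le> b" for k
      using \<phi>(2) by simp
  qed simp
  then have lim: "(\<lambda>k. \<bar>(\<integral>\<omega>. \<phi> (\<omega> (N k \<omega>)) \<partial>law x) - \<phi> x\<bar>) \<longlonglongrightarrow> \<bar>(\<integral>\<omega>. \<phi> (\<omega> (LEAST s. Q s \<omega>)) \<partial>law x) - \<phi> x\<bar>"
    by (intro tendsto_rabs tendsto_diff tendsto_const)
  have "\<bar>(\<integral>\<omega>. \<phi> (\<omega> (N k \<omega>)) \<partial>law x) - \<phi> x\<bar> \<le> \<delta> * T" for k
    using stopped[of k] mult_left_mono[OF T[of k] \<delta>0] unfolding E_def by linarith
  then show "\<bar>(\<integral>\<omega>. \<phi> (\<omega> (LEAST s. Q s \<omega>)) \<partial>law x) - \<phi> x\<bar> \<le> \<delta> * T"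
    by (intro LIMSEQ_le_const2[OF lim]) simp
qed

end

section \<open>Oscillation of partial sums\<close>

text \<open>\<open>hit\<close> and, by \<open>cycle_time_eq\<close>, the cycle time are infima of
  this form. The stopping arguments work with \<open>LEAST\<close> in \<open>nat\<close>, and this
  translates between the two.\<close>

lemma INF_enat_eq_LEAST:
  "(INF s\<in>{s. P s}. enat s) = (if \<exists>s. P s then enat (LEAST s. P s) else \<infinity>)"
proof (cases "\<exists>s. P s")
  case True
  then have "(INF s\<in>{s. P s}. enat s) = enat (LEAST s. P s)"
    by (intro antisym INF_lower INF_greatest) (auto intro: LeastI_ex Least_le)
  then show ?thesis using True by simp
next
  case False
  then have "{s. P s} = {}" by simp
  then show ?thesis using False by (simp only: image_empty Inf_enat_def) simp
qed

text \<open>Tail-sum formula along one path: j is counted exactly when it precedes the first signal.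
  Integrated, it turns a bound on the expected stopping time into the hypothesis of
  \<open>dynkin_bound\<close>.\<close>

lemma sum_alive_le_first:
  "(\<Sum>j<k. indicator {\<omega>. \<forall>s\<le>j. \<not> Q s \<omega>} \<omega>) \<le> ennreal_of_enat (INF s\<in>{s. Q s \<omega>}. enat s)"
proof (cases "\<exists>s. Q s \<omega>")
  case True
  define n where "n = (LEAST s. Q s \<omega>)"
  have "Q n \<omega>" unfolding n_def using True by (rule LeastI_ex)
  then have "(\<Sum>j<k. indicator {\<omega>. \<forall>s\<le>j. \<not> Q s \<omega>} \<omega> :: ennreal) \<le> (\<Sum>j<k. if j < n then 1 else 0)"
    by (intro sum_mono) (auto simp: indicator_def not_less)
  also have "\<dots> = of_nat (card ({..<k} \<inter> {j. j < n}))"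
    by (simp add: sum.If_cases)
  also have "\<dots> \<le> of_nat n"
    using card_mono[of "{..<n}" "{..<k} \<inter> {j. j < n}"] by (intro of_nat_mono) auto
  finally show ?thesis
    using True by (simp add: INF_enat_eq_LEAST n_def)
next
  case False
  then show ?thesis by (simp only: INF_enat_eq_LEAST if_False) simp
qed

text \<open>Since the values are integers or infinite, the second moment in (EC) controls the
  expected cycle length.\<close>

lemma ennreal_of_enat_le_power2: "ennreal_of_enat n \<le> (ennreal_of_enat n)\<^sup>2"
proof (cases n)
  case (enat m)
  have "m \<le> m ^ 2" by (simp add: power2_eq_square)
  then have "(of_nat m :: ennreal) \<le> of_nat (m ^ 2)" by (rule of_nat_mono)
  then show ?thesis by (simp add: enat)
qed (simp add: power2_eq_square)

text \<open>A signal decided by the path up to time s, through which the two-stage time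
  \<open>cycle_time\<close> becomes a first occurrence. The case t = s is included because the
  hitting time of the shifted path may be 0.\<close>

definition cycle_end :: "'a set \<Rightarrow> 'a set \<Rightarrow> nat \<Rightarrow> (nat \<Rightarrow> 'a) \<Rightarrow> bool" where
  "cycle_end R1 R s \<omega> \<longleftrightarrow> \<omega> s \<in> R \<and> (\<exists>t\<le>s. \<omega> t \<notin> R1)"

text \<open>The first exit \<open>t0\<close> is the earliest possible witness t. A signal at s
  therefore means that t0 <= s and that the path shifted by \<open>t0\<close> is in \<open>R\<close>
  at time s - t0; the least such s is \<open>t0\<close> plus the hitting time of the shifted
  path.\<close>

lemma cycle_time_eq: "cycle_time R1 R \<omega> = (INF s\<in>{s. cycle_end R1 R s \<omega>}. enat s)"
proof (cases "\<exists>t. \<omega> t \<notin> R1")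
  case False
  then have "hit (- R1) \<omega> = \<infinity>"
    unfolding hit_def by (subst INF_enat_eq_LEAST) simp
  moreover have "(INF s\<in>{s. cycle_end R1 R s \<omega>}. enat s) = \<infinity>"
    using False by (subst INF_enat_eq_LEAST) (simp add: cycle_end_def)
  ultimately show ?thesis
    by (simp only: cycle_time_def enat.case)
next
  case True
  define t0 where "t0 = (LEAST t. \<omega> t \<notin> R1)"
  have t0: "\<omega> t0 \<notin> R1" "\<And>t. \<omega> t \<notin> R1 \<Longrightarrow> t0 \<le> t"
    unfolding t0_def using LeastI_ex[OF True] by (auto intro: Least_le)
  have hit1: "hit (- R1) \<omega> = enat t0"
    unfolding hit_def using True by (subst INF_enat_eq_LEAST) (simp add: t0_def)
  show ?thesis
  proof (cases "\<exists>s. \<omega> (s + t0) \<in> R")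
    case False
    have "\<not> cycle_end R1 R s \<omega>" for s
    proof
      assume "cycle_end R1 R s \<omega>"
      then obtain t where "\<omega> s \<in> R" "t \<le> s" "\<omega> t \<notin> R1" by (auto simp: cycle_end_def)
      with t0(2)[of t] have "\<omega> ((s - t0) + t0) \<in> R" by simp
      with False show False by blast
    qed
    then have "(INF s\<in>{s. cycle_end R1 R s \<omega>}. enat s) = \<infinity>"
      by (subst INF_enat_eq_LEAST) simp
    moreover have "hit R (shift t0 \<omega>) = \<infinity>"
      unfolding hit_def shift_def using False by (subst INF_enat_eq_LEAST) simp
    ultimately show ?thesis
      by (simp add: cycle_time_def hit1)
  next
    case True
    define s0 where "s0 = (LEAST s. \<omega> (s + t0) \<in> R)"
    have s0: "\<omega> (s0 + t0) \<in> R" "\<And>s. \<omega> (s + t0) \<in> R \<Longrightarrow> s0 \<le> s"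
      unfolding s0_def using LeastI_ex[OF True] by (auto intro: Least_le)
    have 1: "cycle_end R1 R (s0 + t0) \<omega>"
      using s0(1) t0(1) unfolding cycle_end_def by (metis le_add2)
    have "(LEAST s. cycle_end R1 R s \<omega>) = s0 + t0"
    proof (rule Least_equality)
      show "cycle_end R1 R (s0 + t0) \<omega>" by (rule 1)
      fix s assume "cycle_end R1 R s \<omega>"
      then obtain t where t: "\<omega> s \<in> R" "t \<le> s" "\<omega> t \<notin> R1" by (auto simp: cycle_end_def)
      then have "t0 \<le> s" using t0(2)[of t] by simp
      with s0(2)[of "s - t0"] t show "s0 + t0 \<le> s" by simp
    qed
    then have "(INF s\<in>{s. cycle_end R1 R s \<omega>}. enat s) = enat (s0 + t0)"
      using 1 by (subst INF_enat_eq_LEAST) auto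
    moreover have "hit R (shift t0 \<omega>) = enat s0"
      unfolding hit_def shift_def using True by (subst INF_enat_eq_LEAST) (simp add: s0_def)
    ultimately show ?thesis
      by (simp add: cycle_time_def hit1)
  qed
qed

lemma pred_coordinate:
  fixes R :: "'a::topological_space set"
  assumes "R \<in> sets borel" "t \<in> I"
  shows "Measurable.pred (PiM I (\<lambda>_. borel)) (\<lambda>\<omega>. \<omega> t \<in> R)"
proof -
  have "Measurable.pred borel (\<lambda>y. y \<in> R)" using assms(1) by (simp add: pred_def)
  from measurable_compose[OF measurable_component_singleton[OF assms(2)] this] show ?thesis .
qed

lemma adapted_hit:
  assumes "R \<in> sets borel"
  shows "adapted (\<lambda>s \<omega>. \<omega> s \<in> R)"
  unfolding adapted_def by (intro allI conjI pred_coordinate assms) simp_all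

lemma adapted_cycle_end:
  fixes R R1 :: "'a::topological_space set"
  assumes "R \<in> sets borel" "R1 \<in> sets borel"
  shows "adapted (cycle_end R1 R)"
  unfolding adapted_def
proof (intro allI conjI)
  fix k
  have "Measurable.pred (PiM {0..<Suc k} (\<lambda>_. borel)) (\<lambda>\<omega>. \<omega> k \<in> R \<and> (\<exists>t\<in>{..k}. \<not> \<omega> t \<in> R1))"
    by (intro pred_intros_logic(3) pred_intros_finite(4) pred_intros_logic(2)
        pred_coordinate assms) auto
  also have "(\<lambda>\<omega>. \<omega> k \<in> R \<and> (\<exists>t\<in>{..k}. \<not> \<omega> t \<in> R1)) = cycle_end R1 R k"
    by (auto simp: cycle_end_def fun_eq_iff)
  finally show "Measurable.pred (PiM {0..<Suc k} (\<lambda>_. borel)) (cycle_end R1 R k)" .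
  fix \<omega> :: "nat \<Rightarrow> 'a"
  show "cycle_end R1 R k (restrict \<omega> {0..<Suc k}) = cycle_end R1 R k \<omega>"
    unfolding cycle_end_def by (simp add: less_Suc_eq_le cong: conj_cong)
qed

context markov_chain
begin

lemma first_measurable:
  assumes "adapted Q"
  shows "(\<lambda>\<omega>. \<omega> (LEAST s. Q s \<omega>)) \<in> law x \<rightarrow>\<^sub>M borel"
  using adapted_measurable[OF assms] coordinate_measurable
  by (intro measurable_compose_countable[where f = "\<lambda>i \<omega>. \<omega> i" and g = "\<lambda>\<omega>. LEAST s. Q s \<omega>"] measurable_Least)

lemma sum_alive_bound:
  assumes Q: "adapted Q" and "0 \<le> T"
    and "(\<integral>\<^sup>+\<omega>. ennreal_of_enat (INF s\<in>{s. Q s \<omega>}. enat s) \<partial>law x) \<le> ennreal T"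
  shows "(\<Sum>j<k. measure (law x) {\<omega>. \<forall>s\<le>j. \<not> Q s \<omega>}) \<le> T"
proof -
  note adapted_measurable[OF Q, measurable]
  have "Measurable.pred (law x) (\<lambda>\<omega>. \<forall>s\<le>j. \<not> Q s \<omega>)" for j by measurable
  then have sets: "{\<omega>. \<forall>s\<le>j. \<not> Q s \<omega>} \<in> sets (law x)" for j by (simp add: pred_def)
  have "ennreal (\<Sum>j<k. measure (law x) {\<omega>. \<forall>s\<le>j. \<not> Q s \<omega>})
    = (\<Sum>j<k. emeasure (law x) {\<omega>. \<forall>s\<le>j. \<not> Q s \<omega>})"
    by (simp add: law.emeasure_eq_measure sum_ennreal)
  also have "\<dots> = (\<integral>\<^sup>+\<omega>. (\<Sum>j<k. indicator {\<omega>. \<forall>s\<le>j. \<not> Q s \<omega>} \<omega>) \<partial>law x)"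
    using sets by (subst nn_integral_sum) auto
  also have "\<dots> \<le> (\<integral>\<^sup>+\<omega>. ennreal_of_enat (INF s\<in>{s. Q s \<omega>}. enat s) \<partial>law x)"
    by (intro nn_integral_mono sum_alive_le_first)
  also have "\<dots> \<le> ennreal T" by fact
  finally show ?thesis using \<open>0 \<le> T\<close> by (simp add: ennreal_le_iff)
qed

section \<open>Partial sums of the iterated transition operator\<close>

definition partial_sum :: "nat \<Rightarrow> ('a \<Rightarrow> real) \<Rightarrow> 'a \<Rightarrow> real" where
  "partial_sum n f x = (\<Sum>i<n. (trans_op ^^ i) f x)"

lemma partial_sum_measurable:
  assumes "f \<in> borel_measurable borel" "\<And>x. \<bar>f x\<bar> \<le> b"
  shows "partial_sum n f \<in> borel_measurable borel"
  unfolding partial_sum_def[abs_def] using funpow_trans_op(1)[OF assms] by (intro borel_measurable_sum)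

lemma partial_sum_bound:
  assumes "f \<in> borel_measurable borel" "\<And>x. \<bar>f x\<bar> \<le> b"
  shows "\<bar>partial_sum n f x\<bar> \<le> n * b"
proof -
  have "\<bar>partial_sum n f x\<bar> \<le> (\<Sum>i<n. \<bar>(trans_op ^^ i) f x\<bar>)"
    unfolding partial_sum_def by (rule sum_abs)
  also have "\<dots> \<le> (\<Sum>i<n. b)"
    by (intro sum_mono funpow_trans_op(2) assms)
  finally show ?thesis by simp
qed

lemma trans_op_partial_sum:
  assumes "f \<in> borel_measurable borel" "\<And>x. \<bar>f x\<bar> \<le> b"
  shows "trans_op (partial_sum n f) x = partial_sum n f x + (trans_op ^^ n) f x - f x"
proof -
  have "trans_op (partial_sum n f) x = (\<Sum>i<n. trans_op ((trans_op ^^ i) f) x)"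
    unfolding trans_op_def[of "partial_sum n f"] partial_sum_def trans_op_def[of "(trans_op ^^ i) f" for i]
    by (intro Bochner_Integration.integral_sum kernel_integrable[OF funpow_trans_op[OF assms]])
  also have "\<dots> = (\<Sum>i<n. (trans_op ^^ Suc i) f x)"
    by simp
  also have "\<dots> = partial_sum n f x + (trans_op ^^ n) f x - f x"
    unfolding partial_sum_def by (induction n) auto
  finally show ?thesis .
qed

end

text \<open>The bounds below depend on the chain only through the three constants, so values common
  to all controls make them uniform. Expected times appear as tail sums, the form that
  \<open>dynkin_bound\<close> consumes.\<close>

locale regenerative_chain = markov_chain K for K :: "'a::t1_space \<Rightarrow> 'a measure" +
  fixes R R1 :: "'a set" and T\<^sub>1 T\<^sub>2 \<Delta> :: real
  assumes R: "R \<in> sets borel" "R \<noteq> {}" and R1: "R1 \<in> sets borel"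
    and cycle: "\<And>x k. x \<in> R \<Longrightarrow> (\<Sum>j<k. measure (law x) {\<omega>. \<forall>s\<le>j. \<not> cycle_end R1 R s \<omega>}) \<le> T\<^sub>1"
    and hitting: "\<And>x k. (\<Sum>j<k. measure (law x) {\<omega>. \<forall>s\<le>j. \<not> \<omega> s \<in> R}) \<le> T\<^sub>2"
    and mixing: "\<And>x x' B. x \<in> R \<Longrightarrow> x' \<in> R \<Longrightarrow> B \<in> sets borel \<Longrightarrow>
      \<bar>measure (law x) {\<omega>. \<omega> (LEAST s. cycle_end R1 R s \<omega>) \<in> B}
       - measure (law x') {\<omega>. \<omega> (LEAST s. cycle_end R1 R s \<omega>) \<in> B}\<bar> \<le> \<Delta>"
    and \<Delta>: "\<Delta> < 1"
begin

lemma partial_sum_oscillation_R: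
  assumes f: "f \<in> borel_measurable borel" "\<And>x. \<bar>f x\<bar> \<le> 1" and "x \<in> R" "x' \<in> R"
  shows "\<bar>partial_sum n f x - partial_sum n f x'\<bar> \<le> 4 * T\<^sub>1 / (1 - \<Delta>)"
proof -
  define \<phi> where "\<phi> = partial_sum n f"
  have \<phi>: "\<phi> \<in> borel_measurable borel" "\<And>x. \<bar>\<phi> x\<bar> \<le> n"
    unfolding \<phi>_def using partial_sum_measurable[OF f] partial_sum_bound[OF f] by auto
  have \<delta>: "\<bar>trans_op \<phi> y - \<phi> y\<bar> \<le> 2" for y
    using f(2)[of y] funpow_trans_op(2)[OF f, of n y] unfolding \<phi>_def trans_op_partial_sum[OF f] by linarith
  \<comment> \<open>Both are finite because \<open>\<phi>\<close> is bounded by n. This permits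
    moving \<open>\<Delta> * (M - m)\<close> to the left-hand side at the end.\<close>
  define m M where "m = Inf (\<phi> ` R)" and "M = Sup (\<phi> ` R)"
  have bdd: "bdd_below (\<phi> ` R)" "bdd_above (\<phi> ` R)"
    using \<phi>(2) by (auto simp: abs_le_iff minus_le_iff intro!: bdd_belowI[of _ "- real n"] bdd_aboveI[of _ "real n"])
  have mM: "m \<le> \<phi> y" "\<phi> y \<le> M" if "y \<in> R" for y
    unfolding m_def M_def using that bdd by (auto intro: cINF_lower cSUP_upper)
  let ?N = "\<lambda>\<omega>. LEAST s. cycle_end R1 R s \<omega>"
  note ad = adapted_cycle_end[OF R(1) R1]
  obtain z where z: "z \<in> R" using R(2) by auto
  \<comment> \<open>Outside \<open>R\<close>, \<open>\<phi>\<close> may leave the interval from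
    \<open>m\<close> to \<open>M\<close>. Replacing it there by its value at a point of
    \<open>R\<close> keeps the width M - m in the total variation bound; integrals do not change,
    since cycles end in \<open>R\<close>.\<close>
  define \<psi> where "\<psi> y = (if y \<in> R then \<phi> y else \<phi> z)" for y
  have \<psi>: "\<psi> \<in> borel_measurable borel"
    unfolding \<psi>_def[abs_def] using \<phi>(1) R(1) by measurable
  have \<psi>mM: "m \<le> \<psi> y" "\<psi> y \<le> M" for y
    unfolding \<psi>_def using mM z by auto
  define \<mu> where "\<mu> x = distr (law x) borel (\<lambda>\<omega>. \<omega> (?N \<omega>))" for x
  have \<mu>: "prob_space (\<mu> x)" "sets (\<mu> x) = sets borel" for x
    unfolding \<mu>_def using first_measurable[OF ad] by (auto intro: law.prob_space_distr)
  have dist: "\<bar>(\<integral>y. \<psi> y \<partial>\<mu> x) - \<phi> x\<bar> \<le> 2 * T\<^sub>1" if x: "x \<in> R" for x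
  proof -
    note D = dynkin_bound[OF ad \<phi> \<delta> cycle[OF x]]
    have "(\<integral>y. \<psi> y \<partial>\<mu> x) = (\<integral>\<omega>. \<psi> (\<omega> (?N \<omega>)) \<partial>law x)"
      unfolding \<mu>_def using first_measurable[OF ad] \<psi> by (rule integral_distr)
    also have "\<dots> = (\<integral>\<omega>. \<phi> (\<omega> (?N \<omega>)) \<partial>law x)"
    proof (rule integral_cong_AE)
      show "AE \<omega> in law x. \<psi> (\<omega> (?N \<omega>)) = \<phi> (\<omega> (?N \<omega>))"
        using D(1)
      proof eventually_elim
        case (elim \<omega>)
        then have "cycle_end R1 R (?N \<omega>) \<omega>" by (rule LeastI_ex)
        then show ?case by (simp add: cycle_end_def \<psi>_def)
      qed
      show "(\<lambda>\<omega>. \<psi> (\<omega> (?N \<omega>))) \<in> borel_measurable (law x)"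
        by (rule measurable_compose[OF first_measurable[OF ad] \<psi>])
      show "(\<lambda>\<omega>. \<phi> (\<omega> (?N \<omega>))) \<in> borel_measurable (law x)"
        by (rule measurable_compose[OF first_measurable[OF ad] \<phi>(1)])
    qed
    finally show ?thesis using D(2) by simp
  qed
  have meas: "measure (\<mu> x) B = measure (law x) {\<omega>. \<omega> (?N \<omega>) \<in> B}" if "B \<in> sets borel" for x B
    unfolding \<mu>_def using first_measurable[OF ad] that by (subst measure_distr) (auto simp: vimage_def)
  \<comment> \<open>Dynkin's formula with increment bound 2 costs \<open>2 * T\<^sub>1\<close> at
    each of the two starting points.\<close>
  have contract: "\<phi> x \<le> \<phi> x' + (\<Delta> * (M - m) + 4 * T\<^sub>1)" if x: "x \<in> R" "x' \<in> R" for x x'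
  proof -
    have "\<bar>(\<integral>y. \<psi> y \<partial>\<mu> x) - (\<integral>y. \<psi> y \<partial>\<mu> x')\<bar> \<le> \<Delta> * (M - m)"
      by (rule total_variation_integral[OF \<mu> \<mu> \<psi> \<psi>mM]) (simp add: meas mixing[OF x])
    then show ?thesis using dist[OF x(1)] dist[OF x(2)] by linarith
  qed
  \<comment> \<open>The estimate holds for all pairs, so the supremum is taken over the first point
    and then the infimum over the second.\<close>
  have "M - (\<Delta> * (M - m) + 4 * T\<^sub>1) \<le> \<phi> x'" if "x' \<in> R" for x'
  proof -
    have "Sup (\<phi> ` R) \<le> \<phi> x' + (\<Delta> * (M - m) + 4 * T\<^sub>1)"
      using contract[OF _ that] R(2) by (intro cSUP_least)
    then show ?thesis by (simp add: M_def)
  qed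
  then have "M - (\<Delta> * (M - m) + 4 * T\<^sub>1) \<le> Inf (\<phi> ` R)"
    using R(2) by (intro cINF_greatest)
  then have "M - (\<Delta> * (M - m) + 4 * T\<^sub>1) \<le> m"
    by (simp only: m_def)
  then have "(1 - \<Delta>) * (M - m) \<le> 4 * T\<^sub>1" by (simp add: algebra_simps)
  then have "M - m \<le> 4 * T\<^sub>1 / (1 - \<Delta>)"
    using \<Delta> by (simp add: pos_le_divide_eq mult.commute)
  then show ?thesis
    using mM[OF \<open>x \<in> R\<close>] mM[OF \<open>x' \<in> R\<close>] unfolding \<phi>_def by linarith
qed

text \<open>From any start the chain is followed to its first visit of \<open>R\<close>, at cost
  \<open>2 * T\<^sub>2\<close>, where the bound on \<open>R\<close> compares it with a fixed
  \<open>z\<close>. Passing through \<open>z\<close> from both points doubles the total.\<close>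

lemma partial_sum_oscillation:
  assumes f: "f \<in> borel_measurable borel" "\<And>x. \<bar>f x\<bar> \<le> 1"
  shows "\<bar>partial_sum n f x - partial_sum n f x'\<bar> \<le> 4 * T\<^sub>2 + 8 * T\<^sub>1 / (1 - \<Delta>)"
proof -
  obtain z where z: "z \<in> R" using R(2) by auto
  define \<phi> where "\<phi> = partial_sum n f"
  have \<phi>: "\<phi> \<in> borel_measurable borel" "\<And>x. \<bar>\<phi> x\<bar> \<le> n"
    unfolding \<phi>_def using partial_sum_measurable[OF f] partial_sum_bound[OF f] by auto
  have \<delta>: "\<bar>trans_op \<phi> y - \<phi> y\<bar> \<le> 2" for y
    using f(2)[of y] funpow_trans_op(2)[OF f, of n y] unfolding \<phi>_def trans_op_partial_sum[OF f] by linarith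
  let ?N = "\<lambda>\<omega>. LEAST s. \<omega> s \<in> R"
  note ad = adapted_hit[OF R(1)]
  have near_z: "\<bar>\<phi> x - \<phi> z\<bar> \<le> 2 * T\<^sub>2 + 4 * T\<^sub>1 / (1 - \<Delta>)" for x
  proof -
    note D = dynkin_bound[OF ad \<phi> \<delta> hitting]
    have m: "(\<lambda>\<omega>. \<phi> (\<omega> (?N \<omega>))) \<in> borel_measurable (law x)"
      by (rule measurable_compose[OF first_measurable[OF ad] \<phi>(1)])
    then have i: "integrable (law x) (\<lambda>\<omega>. \<phi> (\<omega> (?N \<omega>)))"
      using \<phi>(2) by (rule law.integrable_bounded)
    have "\<bar>(\<integral>\<omega>. \<phi> (\<omega> (?N \<omega>)) \<partial>law x) - \<phi> z\<bar> = \<bar>\<integral>\<omega>. \<phi> (\<omega> (?N \<omega>)) - \<phi> z \<partial>law x\<bar>"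
      using i by (simp add: law.prob_space[simplified])
    also have "\<dots> \<le> (\<integral>\<omega>. \<bar>\<phi> (\<omega> (?N \<omega>)) - \<phi> z\<bar> \<partial>law x)"
      by (rule integral_abs_bound)
    also have "\<dots> \<le> (\<integral>\<omega>. 4 * T\<^sub>1 / (1 - \<Delta>) \<partial>law x)"
    proof (rule integral_mono_AE)
      show "integrable (law x) (\<lambda>\<omega>. \<bar>\<phi> (\<omega> (?N \<omega>)) - \<phi> z\<bar>)"
        using i by simp
      show "AE \<omega> in law x. \<bar>\<phi> (\<omega> (?N \<omega>)) - \<phi> z\<bar> \<le> 4 * T\<^sub>1 / (1 - \<Delta>)"
        using D(1)
      proof eventually_elim
        case (elim \<omega>)
        then have "\<omega> (?N \<omega>) \<in> R" by (rule LeastI_ex)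
        then show ?case unfolding \<phi>_def by (rule partial_sum_oscillation_R[OF f _ z])
      qed
    qed simp
    finally have "\<bar>(\<integral>\<omega>. \<phi> (\<omega> (?N \<omega>)) \<partial>law x) - \<phi> z\<bar> \<le> 4 * T\<^sub>1 / (1 - \<Delta>)"
      by (simp add: law.prob_space[simplified])
    then show ?thesis using D(2)[of x] by linarith
  qed
  show ?thesis using near_z[of x] near_z[of x'] unfolding \<phi>_def by linarith
qed

end

section \<open>Invariant laws\<close>

context markov_chain
begin

lemma integral_partial_sum_path:
  assumes "f \<in> borel_measurable borel" "\<And>x. \<bar>f x\<bar> \<le> b"
  shows "(\<integral>\<omega>. (\<Sum>i<n. f (\<omega> i)) \<partial>law x) = partial_sum n f x"
proof -
  have "integrable (law x) (\<lambda>\<omega>. f (\<omega> i))" for i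
    using measurable_compose[OF coordinate_measurable assms(1)] assms(2) by (rule law.integrable_bounded)
  then show ?thesis
    using integral_law_coordinate[OF assms] by (simp add: partial_sum_def)
qed

lemma partial_sum_add:
  assumes f: "f \<in> borel_measurable borel" "\<And>x. \<bar>f x\<bar> \<le> b"
  shows "partial_sum (n + m) f x = partial_sum n f x + (\<integral>\<omega>. partial_sum m f (\<omega> n) \<partial>law x)"
proof -
  note g = funpow_trans_op[OF f]
  have "integrable (law x) (\<lambda>\<omega>. (trans_op ^^ i) f (\<omega> n))" for i
    using measurable_compose[OF coordinate_measurable g(1)] g(2) by (rule law.integrable_bounded)
  then have "(\<integral>\<omega>. partial_sum m f (\<omega> n) \<partial>law x) = (\<Sum>i<m. \<integral>\<omega>. (trans_op ^^ i) f (\<omega> n) \<partial>law x)"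
    unfolding partial_sum_def by (rule Bochner_Integration.integral_sum)
  also have "\<dots> = (\<Sum>i<m. (trans_op ^^ (n + i)) f x)"
    by (intro sum.cong refl) (simp add: integral_law_coordinate[OF g] funpow_add)
  finally have "(\<integral>\<omega>. partial_sum m f (\<omega> n) \<partial>law x) = (\<Sum>i<m. (trans_op ^^ (n + i)) f x)" .
  moreover have "(\<Sum>i<n + m. h i) = (\<Sum>i<n. h i) + (\<Sum>i<m. h (n + i))" for h :: "nat \<Rightarrow> real"
    by (induction m) (simp_all add: add_ac)
  ultimately show ?thesis
    by (simp only: partial_sum_def)
qed

text \<open>The Cesaro mean of the first n laws, as the law of the chain at a time uniform on
  {..<n}. Being a \<open>bind\<close> over a \<open>pmf\<close>, it is a probability measure by
  construction; for n = 0 the \<open>pmf\<close> is unspecified, hence the condition 0 < n in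
  \<open>integral_occupation\<close>.\<close>

definition occupation :: "nat \<Rightarrow> 'a \<Rightarrow> 'a measure" where
  "occupation n x = measure_pmf (pmf_of_set {..<n}) \<bind> (\<lambda>i. distr (law x) borel (\<lambda>\<omega>. \<omega> i))"

lemma occupation_kernel:
  "(\<lambda>i. distr (law x) borel (\<lambda>\<omega>. \<omega> i)) \<in> measure_pmf p \<rightarrow>\<^sub>M subprob_algebra borel"
proof -
  have "prob_space (distr (law x) borel (\<lambda>\<omega>. \<omega> i))" for i
    using coordinate_measurable by (rule law.prob_space_distr)
  then show ?thesis
    by (auto simp: measurable_def space_subprob_algebra prob_space_imp_subprob_space)
qed

lemma occupation_prob_space: "prob_space (occupation n x)"
  unfolding occupation_def
  by (rule measure_pmf.prob_space_bind[OF _ occupation_kernel])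
     (simp add: law.prob_space_distr coordinate_measurable)

lemma sets_occupation [simp]: "sets (occupation n x) = sets borel"
  unfolding occupation_def by (rule sets_bind) auto

lemma integral_occupation:
  assumes f: "f \<in> borel_measurable borel" "\<And>x. \<bar>f x\<bar> \<le> b" and n: "0 < n"
  shows "(\<integral>y. f y \<partial>occupation n x) = partial_sum n f x / n"
proof -
  have "(\<integral>y. f y \<partial>occupation n x)
    = (\<integral>i. (\<integral>y. f y \<partial>distr (law x) borel (\<lambda>\<omega>. \<omega> i)) \<partial>measure_pmf (pmf_of_set {..<n}))"
    unfolding occupation_def
  proof (rule integral_bind[OF f(1) _ occupation_kernel])
    show "AE i in measure_pmf (pmf_of_set {..<n}). emeasure (distr (law x) borel (\<lambda>\<omega>. \<omega> i))
        (space (distr (law x) borel (\<lambda>\<omega>. \<omega> i))) \<le> ennreal 1"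
      by (simp add: emeasure_distr coordinate_measurable law.emeasure_eq_measure)
    show "finite_measure (measure_pmf (pmf_of_set {..<n}))" by unfold_locales
  qed (rule f(2))
  also have "\<dots> = (\<Sum>i<n. (\<integral>y. f y \<partial>distr (law x) borel (\<lambda>\<omega>. \<omega> i))) / n"
    using n by (subst integral_pmf_of_set) auto
  also have "\<dots> = (\<Sum>i<n. (\<integral>\<omega>. f (\<omega> i) \<partial>law x)) / n"
    by (simp add: integral_distr[OF coordinate_measurable f(1)])
  finally show ?thesis
    by (simp add: integral_law_coordinate[OF f] partial_sum_def)
qed

text \<open>Invariance is defined on sets; rewritten as \<open>\<pi> = \<pi> \<bind> K\<close>, it
  extends to bounded functions by integrating in two stages.\<close>

lemma invariant_prob_trans_op:
  assumes \<pi>: "invariant_prob K \<pi>" and f: "f \<in> borel_measurable borel" "\<And>x. \<bar>f x\<bar> \<le> b"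
  shows "(\<integral>x. trans_op f x \<partial>\<pi>) = (\<integral>x. f x \<partial>\<pi>)"
proof -
  interpret \<pi>: prob_space \<pi> using \<pi> by (simp add: invariant_prob_def)
  have s: "sets \<pi> = sets borel" using \<pi> by (simp add: invariant_prob_def)
  have k: "K \<in> \<pi> \<rightarrow>\<^sub>M subprob_algebra borel"
    using kernel_subprob by (simp add: measurable_cong_sets[OF s refl])
  have "\<pi> = \<pi> \<bind> K"
  proof (rule measure_eqI)
    show "sets \<pi> = sets (\<pi> \<bind> K)"
      using s \<pi>.not_empty by (subst sets_bind[where N = borel]) auto
    fix B assume "B \<in> sets \<pi>"
    then have "B \<in> sets borel" using s by simp
    then show "emeasure \<pi> B = emeasure (\<pi> \<bind> K) B"
      using \<pi> k by (subst emeasure_bind[OF \<pi>.not_empty]) (auto simp: invariant_prob_def)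
  qed
  then have "(\<integral>x. f x \<partial>\<pi>) = (\<integral>x. f x \<partial>(\<pi> \<bind> K))" by simp
  also have "\<dots> = (\<integral>x. (\<integral>y. f y \<partial>K x) \<partial>\<pi>)"
  proof (rule integral_bind[OF f(1) f(2) k])
    show "AE x in \<pi>. emeasure (K x) (space (K x)) \<le> ennreal 1"
      using kernel.emeasure_space_1 by simp
    show "finite_measure \<pi>" by unfold_locales
  qed
  finally show ?thesis by (simp add: trans_op_def)
qed

end

text \<open>Bounded oscillation is all that the ergodic theory below assumes of the chain, so a
  \<open>C\<close> shared by a family of chains yields shared rates of convergence.\<close>

locale cesaro_ergodic_chain = markov_chain K for K :: "'a::t1_space \<Rightarrow> 'a measure" +
  fixes C :: real
  assumes oscillation: "\<And>n f x y. f \<in> borel_measurable borel \<Longrightarrow> (\<And>x. \<bar>f x\<bar> \<le> 1) \<Longrightarrow>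
    \<bar>partial_sum n f x - partial_sum n f y\<bar> \<le> C"
begin

lemma C_nonneg: "0 \<le> C"
  using oscillation[of "\<lambda>_. 0" 0 undefined undefined] by simp

text \<open>The last m terms start from the random state at time n instead of x, which the
  oscillation bound prices at \<open>C\<close>.\<close>

lemma partial_sum_near_additive:
  assumes f: "f \<in> borel_measurable borel" "\<And>x. \<bar>f x\<bar> \<le> 1"
  shows "\<bar>partial_sum (n + m) f x - (partial_sum n f x + partial_sum m f x)\<bar> \<le> C"
proof -
  have i: "integrable (law x) (\<lambda>\<omega>. partial_sum m f (\<omega> n))"
    using measurable_compose[OF coordinate_measurable partial_sum_measurable[OF f]] partial_sum_bound[OF f]
    by (rule law.integrable_bounded)
  have "\<bar>(\<integral>\<omega>. partial_sum m f (\<omega> n) \<partial>law x) - (\<integral>\<omega>. partial_sum m f x \<partial>law x)\<bar> \<le> C"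
    using i oscillation[OF f] by (intro law.abs_expectation_diff_le) auto
  then show ?thesis
    by (simp add: partial_sum_add[OF f] law.prob_space[simplified])
qed

lemma partial_sum_mult:
  assumes f: "f \<in> borel_measurable borel" "\<And>x. \<bar>f x\<bar> \<le> 1"
  shows "\<bar>partial_sum (k * n) f x - k * partial_sum n f x\<bar> \<le> k * C"
proof (induction k)
  case 0
  show ?case by (simp add: partial_sum_def)
next
  case (Suc k)
  then show ?case
    using partial_sum_near_additive[OF f, of n "k * n" x] by (simp add: algebra_simps)
qed

text \<open>Both averages are compared with the one over n * m steps, read as m blocks of length n
  or as n blocks of length m; every block costs at most \<open>C\<close>.\<close>

lemma average_cauchy:
  assumes f: "f \<in> borel_measurable borel" "\<And>x. \<bar>f x\<bar> \<le> 1" and "0 < n" "0 < m"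
  shows "\<bar>partial_sum n f x / n - partial_sum m f x / m\<bar> \<le> C / n + C / m"
proof -
  have half: "\<bar>partial_sum (k * n) f x / (real k * n) - partial_sum n f x / n\<bar> \<le> C / n"
    if "0 < k" "0 < n" for k n
  proof -
    have "partial_sum (k * n) f x / (real k * n) - partial_sum n f x / n
      = (partial_sum (k * n) f x - k * partial_sum n f x) / (real k * n)"
      using that by (simp add: field_simps)
    also have "\<bar>\<dots>\<bar> \<le> (k * C) / (real k * n)"
      using divide_right_mono[OF partial_sum_mult[OF f, of k n x], of "real k * n"]
      by (simp only: abs_divide) simp
    also have "\<dots> = C / n" using that by simp
    finally show ?thesis .
  qed
  show ?thesis
    using half[of m n] half[of n m] assms(3,4) by (simp add: mult.commute abs_le_iff)
qed

text \<open>Letting m tend to infinity in \<open>average_cauchy\<close> removes C / m and keeps the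
  rate C / n.\<close>

lemma average_limit:
  assumes f: "f \<in> borel_measurable borel" "\<And>x. \<bar>f x\<bar> \<le> 1"
  shows "\<exists>l. \<forall>n>0. \<bar>partial_sum n f x / n - l\<bar> \<le> C / n"
proof -
  define X where "X n = partial_sum (Suc n) f x / real (Suc n)" for n
  have c0: "(\<lambda>n. C / real (Suc n)) \<longlonglongrightarrow> 0"
    by (intro LIMSEQ_Suc lim_const_over_n)
  have "Cauchy X"
  proof (rule CauchyI)
    fix e :: real assume "0 < e"
    with LIMSEQ_D[OF c0, of "e / 2"] obtain N where N: "\<And>n. N \<le> n \<Longrightarrow> C / real (Suc n) < e / 2"
      by (auto simp: C_nonneg)
    have "norm (X m - X n) < e" if "N \<le> m" "N \<le> n" for m n
      using average_cauchy[OF f, of "Suc m" "Suc n" x] N[OF that(1)] N[OF that(2)]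
      unfolding X_def real_norm_def by linarith
    then show "\<exists>M. \<forall>m\<ge>M. \<forall>n\<ge>M. norm (X m - X n) < e" by blast
  qed
  then obtain l where l: "X \<longlonglongrightarrow> l" using Cauchy_convergent convergent_def by blast
  have "\<bar>partial_sum n f x / n - l\<bar> \<le> C / n" if "0 < n" for n
  proof -
    have "(\<lambda>k. \<bar>partial_sum n f x / n - X k\<bar>) \<longlonglongrightarrow> \<bar>partial_sum n f x / n - l\<bar>"
      by (intro tendsto_rabs tendsto_diff tendsto_const l)
    moreover have "(\<lambda>k. C / n + C / real (Suc k)) \<longlonglongrightarrow> C / n + 0"
      by (intro tendsto_add tendsto_const c0)
    moreover have "\<bar>partial_sum n f x / n - X k\<bar> \<le> C / n + C / real (Suc k)" for k
      using average_cauchy[OF f that, of "Suc k" x] unfolding X_def by simp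
    ultimately have "\<bar>partial_sum n f x / n - l\<bar> \<le> C / n + 0"
      by (intro LIMSEQ_le) auto
    then show ?thesis by simp
  qed
  then show ?thesis by blast
qed

text \<open>The mean of \<open>partial_sum n f\<close> under \<open>\<pi>\<close> is n times the
  mean of \<open>f\<close>, and a function differs from its mean by at most its oscillation. This
  gives uniqueness, the cost limit and the perturbation bound.\<close>

lemma average_near_invariant:
  assumes \<pi>: "invariant_prob K \<pi>" and f: "f \<in> borel_measurable borel" "\<And>x. \<bar>f x\<bar> \<le> 1" and n: "0 < n"
  shows "\<bar>partial_sum n f x / n - (\<integral>y. f y \<partial>\<pi>)\<bar> \<le> C / n"
proof -
  interpret \<pi>: prob_space \<pi> using \<pi> by (simp add: invariant_prob_def)
  have s: "sets \<pi> = sets borel" using \<pi> by (simp add: invariant_prob_def)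
  have int: "integrable \<pi> g" if "g \<in> borel_measurable borel" "\<And>x. \<bar>g x\<bar> \<le> b" for g :: "'a \<Rightarrow> real" and b
    using that by (intro \<pi>.integrable_bounded) (auto simp: measurable_cong_sets[OF s refl])
  have iter: "(\<integral>y. (trans_op ^^ i) f y \<partial>\<pi>) = (\<integral>y. f y \<partial>\<pi>)" for i
    by (induction i) (simp_all add: invariant_prob_trans_op[OF \<pi> funpow_trans_op[OF f]])
  have "(\<integral>y. partial_sum n f y \<partial>\<pi>) = n * (\<integral>y. f y \<partial>\<pi>)"
    unfolding partial_sum_def
    by (subst Bochner_Integration.integral_sum) (simp_all add: iter int[OF funpow_trans_op[OF f]])
  moreover have "\<bar>(\<integral>y. partial_sum n f x \<partial>\<pi>) - (\<integral>y. partial_sum n f y \<partial>\<pi>)\<bar> \<le> C"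
    using oscillation[OF f] int[OF partial_sum_measurable[OF f] partial_sum_bound[OF f]]
    by (intro \<pi>.abs_expectation_diff_le) auto
  ultimately have "\<bar>partial_sum n f x - n * (\<integral>y. f y \<partial>\<pi>)\<bar> \<le> C"
    by (simp add: \<pi>.prob_space)
  moreover have "partial_sum n f x / n - (\<integral>y. f y \<partial>\<pi>) = (partial_sum n f x - n * (\<integral>y. f y \<partial>\<pi>)) / n"
    using n by (simp add: field_simps)
  ultimately show ?thesis using n by (simp add: divide_right_mono)
qed

lemma invariant_prob_unique:
  assumes "invariant_prob K \<pi>" "invariant_prob K \<pi>'"
  shows "\<pi> = \<pi>'"
proof (rule measure_eqI)
  interpret \<pi>: prob_space \<pi> using assms by (simp add: invariant_prob_def)
  interpret \<pi>': prob_space \<pi>' using assms by (simp add: invariant_prob_def)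
  have s: "sets \<pi> = sets borel" "sets \<pi>' = sets borel" using assms by (simp_all add: invariant_prob_def)
  show "sets \<pi> = sets \<pi>'" using s by simp
  fix B assume "B \<in> sets \<pi>"
  then have B: "B \<in> sets borel" using s by simp
  have ind: "(indicator B :: 'a \<Rightarrow> real) \<in> borel_measurable borel" "\<And>x. \<bar>indicator B x :: real\<bar> \<le> 1"
    using B by (auto simp: indicator_def)
  have "measure \<pi> B = measure \<pi>' B"
  proof (rule eq_if_close)
    fix n :: nat assume n: "0 < n"
    show "\<bar>measure \<pi> B - measure \<pi>' B\<bar> \<le> (2 * C) / n"
      using average_near_invariant[OF assms(1) ind n, of undefined]
        average_near_invariant[OF assms(2) ind n, of undefined] B s
      by (simp add: abs_le_iff)
  qed
  then show "emeasure \<pi> B = emeasure \<pi>' B"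
    by (simp add: \<pi>.emeasure_eq_measure \<pi>'.emeasure_eq_measure)
qed

text \<open>Krylov-Bogoliubov in total variation: the occupation measures converge at rate C / n
  uniformly in B, so the setwise limit is a measure, and the integral of the merely measurable
  function \<open>\<lambda>y. measure (K y) B\<close> passes to the limit too.\<close>

lemma invariant_prob_exists: "\<exists>\<pi>. invariant_prob K \<pi>"
proof -
  fix x :: 'a
  have ind: "(indicator B :: 'a \<Rightarrow> real) \<in> borel_measurable borel" "\<And>x. \<bar>indicator B x :: real\<bar> \<le> 1"
    if "B \<in> sets borel" for B :: "'a set"
    using that by (auto simp: indicator_def)
  have "\<forall>B\<in>sets borel. \<exists>l. \<forall>n>0. \<bar>partial_sum n (indicator B) x / n - l\<bar> \<le> C / n"
    using average_limit[OF ind] by blast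
  then obtain l where l: "\<And>B n. B \<in> sets borel \<Longrightarrow> 0 < n \<Longrightarrow> \<bar>partial_sum n (indicator B) x / n - l B\<bar> \<le> C / n"
    by metis
  have occ: "measure (occupation n x) B = partial_sum n (indicator B) x / n" if "B \<in> sets borel" "0 < n" for B n
    using integral_occupation[OF ind[OF that(1)] that(2), of x] that by simp
  have e: "(\<lambda>n. C / real (Suc n)) \<longlonglongrightarrow> 0"
    by (intro LIMSEQ_Suc lim_const_over_n)
  have near: "\<bar>measure (occupation (Suc n) x) B - l B\<bar> \<le> C / real (Suc n)" if "B \<in> sets borel" for n B
    using l[OF that, of "Suc n"] occ[OF that, of "Suc n"] by simp
  obtain \<pi> where \<pi>: "prob_space \<pi>" "sets \<pi> = sets borel"
    and \<pi>l: "\<And>B. B \<in> sets borel \<Longrightarrow> measure \<pi> B = l B"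
    using uniform_limit_prob_space[of "\<lambda>n. occupation (Suc n) x" borel _ l,
        OF occupation_prob_space sets_occupation e near] by blast
  interpret \<pi>: prob_space \<pi> by fact
  have "emeasure \<pi> B = (\<integral>\<^sup>+y. emeasure (K y) B \<partial>\<pi>)" if B: "B \<in> sets borel" for B
  proof -
    define f where "f = (indicator B :: 'a \<Rightarrow> real)"
    have f: "f \<in> borel_measurable borel" "\<And>x. \<bar>f x\<bar> \<le> 1" using ind[OF B] by (auto simp: f_def)
    define g where "g = trans_op f"
    have gm: "g y = measure (K y) B" for y
      using B by (simp add: g_def f_def trans_op_def)
    have g: "g \<in> borel_measurable borel" "\<And>x. 0 \<le> g x" "\<And>x. g x \<le> 1" "\<And>x. \<bar>g x\<bar> \<le> 1"
      using trans_op_measurable[OF f(1)] by (simp_all add: gm) (simp add: g_def)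
    \<comment> \<open>The error collects C / n for the average of \<open>g\<close>, C / n for that
      of \<open>f\<close>, and 2 / n for the two boundary terms by which their partial sums
      differ.\<close>
    have "measure \<pi> B = (\<integral>y. g y \<partial>\<pi>)"
    proof (rule eq_if_close)
      fix n :: nat assume n: "0 < n"
      have "\<bar>(\<integral>y. g y \<partial>occupation n x) - (\<integral>y. g y \<partial>\<pi>)\<bar> \<le> C / n"
        using occupation_prob_space sets_occupation \<pi> g(1-3)
        by (rule total_variation_integral_unit) (use l occ \<pi>l n in simp)
      moreover have "(\<integral>y. g y \<partial>occupation n x) = partial_sum n g x / n"
        by (rule integral_occupation[OF g(1,4) n])
      moreover have "partial_sum n g x = partial_sum n f x + (trans_op ^^ n) f x - f x"
      proof -
        have "partial_sum n g x = (\<Sum>i<n. (trans_op ^^ Suc i) f x)"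
          unfolding partial_sum_def g_def by (simp add: funpow_swap1)
        also have "\<dots> = partial_sum n f x + (trans_op ^^ n) f x - f x"
          unfolding partial_sum_def by (induction n) auto
        finally show ?thesis .
      qed
      moreover have "\<bar>(trans_op ^^ n) f x - f x\<bar> \<le> 2"
        using funpow_trans_op(2)[OF f, of n x] f(2)[of x] by linarith
      moreover have "\<bar>partial_sum n f x / n - measure \<pi> B\<bar> \<le> C / n"
        using l[OF B n] \<pi>l[OF B] by (simp add: f_def)
      moreover have "partial_sum n g x / n = partial_sum n f x / n + ((trans_op ^^ n) f x - f x) / n"
        using calculation(3) by (simp add: add_divide_distrib diff_divide_distrib)
      moreover have "\<bar>((trans_op ^^ n) f x - f x) / n\<bar> \<le> 2 / n"
        using calculation(4) n by (simp add: divide_right_mono)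
      ultimately have "\<bar>measure \<pi> B - (\<integral>y. g y \<partial>\<pi>)\<bar> \<le> C / n + C / n + 2 / n"
        by linarith
      also have "\<dots> = (2 * C + 2) / n" by (simp add: add_divide_distrib)
      finally show "\<bar>measure \<pi> B - (\<integral>y. g y \<partial>\<pi>)\<bar> \<le> (2 * C + 2) / n" .
    qed
    moreover have "(\<integral>\<^sup>+y. ennreal (g y) \<partial>\<pi>) = ennreal (\<integral>y. g y \<partial>\<pi>)"
      using g by (intro nn_integral_eq_integral \<pi>.integrable_bounded[of _ 1])
        (auto simp: measurable_cong_sets[OF \<pi>(2) refl])
    ultimately show ?thesis
      by (simp add: \<pi>.emeasure_eq_measure kernel.emeasure_eq_measure gm)
  qed
  then show ?thesis using \<pi> unfolding invariant_prob_def by blast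
qed

lemma invariant_prob_THE: "invariant_prob K (THE \<pi>. invariant_prob K \<pi>)"
  using invariant_prob_exists invariant_prob_unique by (rule ex_ex1I[THEN theI'])

lemma path_average_tendsto:
  assumes \<pi>: "invariant_prob K \<pi>" and f: "f \<in> borel_measurable borel" "\<And>x. \<bar>f x\<bar> \<le> b"
  shows "(\<lambda>n. 1 / real n * (\<integral>\<omega>. (\<Sum>i<n. f (\<omega> i)) \<partial>law x)) \<longlonglongrightarrow> (\<integral>y. f y \<partial>\<pi>)"
proof -
  \<comment> \<open>Adding 1 keeps the divisor positive when b = 0.\<close>
  define d where "d = \<bar>b\<bar> + 1"
  have d: "0 < d" "b \<le> d" by (auto simp: d_def)
  define g where "g y = f y / d" for y
  have g: "g \<in> borel_measurable borel" "\<And>x. \<bar>g x\<bar> \<le> 1"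
  proof -
    show "g \<in> borel_measurable borel" unfolding g_def[abs_def] using f(1) by simp
    show "\<bar>g x\<bar> \<le> 1" for x
      unfolding g_def using d f(2)[of x] by (simp add: divide_le_eq_1)
  qed
  have fg: "f y = d * g y" for y using d by (simp add: g_def)
  have "(\<lambda>n. partial_sum n g x / n - (\<integral>y. g y \<partial>\<pi>)) \<longlonglongrightarrow> 0"
  proof (rule Lim_null_comparison[OF _ lim_const_over_n[of C]])
    show "\<forall>\<^sub>F n in sequentially. norm (partial_sum n g x / n - (\<integral>y. g y \<partial>\<pi>)) \<le> C / n"
      using average_near_invariant[OF \<pi> g] by (intro eventually_sequentiallyI[of 1]) simp
  qed
  from tendsto_mult_left[OF LIM_zero_cancel[OF this], of d]
  have "(\<lambda>n. d * (partial_sum n g x / n)) \<longlonglongrightarrow> d * (\<integral>y. g y \<partial>\<pi>)" .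
  moreover have "1 / real n * (\<integral>\<omega>. (\<Sum>i<n. f (\<omega> i)) \<partial>law x) = d * (partial_sum n g x / n)" for n
    unfolding fg sum_distrib_left[symmetric] integral_mult_right_zero integral_partial_sum_path[OF g] by simp
  moreover have "d * (\<integral>y. g y \<partial>\<pi>) = (\<integral>y. f y \<partial>\<pi>)"
    unfolding fg integral_mult_right_zero ..
  ultimately show ?thesis by (simp only:)
qed

end

section \<open>Perturbation of the kernel\<close>

lemma le_cSUP_bounded:
  fixes f :: "'i \<Rightarrow> real"
  assumes "x \<in> A" "\<And>y. y \<in> A \<Longrightarrow> f y \<le> b"
  shows "f x \<le> (SUP y\<in>A. f y)" "(SUP y\<in>A. f y) \<le> b"
  using assms by (auto intro!: cSUP_upper cSUP_least bdd_aboveI[of _ b])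

lemma prob_diff_le_1:
  assumes "prob_space \<mu>" "prob_space \<nu>"
  shows "\<bar>measure \<mu> A - measure \<nu> B\<bar> \<le> 1"
  using prob_space.prob_le_1[OF assms(1), of A] prob_space.prob_le_1[OF assms(2), of B]
    measure_nonneg[of \<mu> A] measure_nonneg[of \<nu> B] by linarith

lemma le_total_variation:
  assumes "prob_space \<mu>" "prob_space \<nu>" "B \<in> sets M"
  shows "\<bar>measure \<mu> B - measure \<nu> B\<bar> \<le> (SUP B\<in>sets M. \<bar>measure \<mu> B - measure \<nu> B\<bar>)"
  using assms by (intro le_cSUP_bounded(1)[where b = 1] prob_diff_le_1)

text \<open>
  Letting the test function vary with \<open>m\<close> encodes uniformity over Borel sets without a supremum
  under the integral, whose measurability would have to be shown for dominated convergence.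
\<close>

lemma funpow_trans_op_tendsto:
  fixes K :: "'a::t1_space \<Rightarrow> 'a measure" and L :: "nat \<Rightarrow> 'a \<Rightarrow> 'a measure"
  assumes K: "markov_kernel K" and L: "\<And>m. markov_kernel (L m)"
    and tv: "\<And>x. (\<lambda>m. SUP B\<in>sets borel. \<bar>measure (L m x) B - measure (K x) B\<bar>) \<longlonglongrightarrow> 0"
    and f: "\<And>m. f m \<in> borel_measurable borel" "\<And>m x. \<bar>f m x\<bar> \<le> 1"
  shows "(\<lambda>m. (markov_chain.trans_op (L m) ^^ i) (f m) x - (markov_chain.trans_op K ^^ i) (f m) x) \<longlonglongrightarrow> 0"
proof (induction i arbitrary: x)
  case 0
  show ?case by simp
next
  case (Suc i)
  interpret K: markov_chain K by unfold_locales (rule K)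
  interpret L: markov_chain "L m" for m by unfold_locales (rule L)
  let ?g = "\<lambda>m. (L.trans_op m ^^ i) (f m)" and ?h = "\<lambda>m. (K.trans_op ^^ i) (f m)"
  let ?d = "\<lambda>m. SUP B\<in>sets borel. \<bar>measure (L m x) B - measure (K x) B\<bar>"
  have g: "?g m \<in> borel_measurable borel" "\<And>y. \<bar>?g m y\<bar> \<le> 1" for m
    by (rule L.funpow_trans_op[OF f])+
  have h: "?h m \<in> borel_measurable borel" "\<And>y. \<bar>?h m y\<bar> \<le> 1" for m
    by (rule K.funpow_trans_op[OF f])+
  have gint: "integrable (K x) (?g m)" and hint: "integrable (K x) (?h m)" for m
    by (rule K.kernel_integrable[OF g], rule K.kernel_integrable[OF h])
  \<comment> \<open>The difference of iterates is (L - K) L^i f + K (L^i f - K^i f). The first term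
    is small in total variation whatever the test function; in the second the measure
    \<open>K x\<close> is fixed, so dominated convergence applies with the induction hypothesis at
    every y.\<close>
  have first: "(\<lambda>m. (\<integral>y. ?g m y \<partial>L m x) - (\<integral>y. ?g m y \<partial>K x)) \<longlonglongrightarrow> 0"
  proof (rule Lim_null_comparison)
    have ab: "- 1 \<le> ?g m y" "?g m y \<le> 1" for m y using g(2)[of m y] by (simp_all add: abs_le_iff)
    have "\<bar>(\<integral>y. ?g m y \<partial>L m x) - (\<integral>y. ?g m y \<partial>K x)\<bar> \<le> ?d m * (1 - (- 1))" for m
      by (rule total_variation_integral[OF L.kernel.prob_space_axioms L.sets_kernel K.kernel.prob_space_axioms K.sets_kernel g(1) ab])
        (rule le_total_variation[OF L.kernel.prob_space_axioms K.kernel.prob_space_axioms])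
    then show "\<forall>\<^sub>F m in sequentially. norm ((\<integral>y. ?g m y \<partial>L m x) - (\<integral>y. ?g m y \<partial>K x)) \<le> ?d m * 2"
      by simp
    show "(\<lambda>m. ?d m * 2) \<longlonglongrightarrow> 0"
      using tendsto_mult_right[OF tv[of x], of 2] by simp
  qed
  have second: "(\<lambda>m. \<integral>y. ?g m y - ?h m y \<partial>K x) \<longlonglongrightarrow> (\<integral>y. 0 \<partial>K x)"
  proof (rule integral_dominated_convergence[where w = "\<lambda>_. 2"])
    show "(\<lambda>y. ?g m y - ?h m y) \<in> borel_measurable (K x)" for m
      using g(1) h(1) by simp
    show "AE y in K x. (\<lambda>m. ?g m y - ?h m y) \<longlonglongrightarrow> 0"
      using Suc.IH by simp
    show "AE y in K x. norm (?g m y - ?h m y) \<le> 2" for m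
    proof (rule AE_I2)
      fix y show "norm (?g m y - ?h m y) \<le> 2"
        using g(2)[of m y] h(2)[of m y] unfolding real_norm_def by linarith
    qed
  qed simp_all
  have "(L.trans_op m ^^ Suc i) (f m) x - (K.trans_op ^^ Suc i) (f m) x
    = ((\<integral>y. ?g m y \<partial>L m x) - (\<integral>y. ?g m y \<partial>K x)) + (\<integral>y. ?g m y - ?h m y \<partial>K x)" for m
    using gint[of m] hint[of m] by (simp add: L.trans_op_def K.trans_op_def)
  then show ?case
    using tendsto_add[OF first second] by simp
qed

lemma partial_sum_tendsto:
  fixes K :: "'a::t1_space \<Rightarrow> 'a measure" and L :: "nat \<Rightarrow> 'a \<Rightarrow> 'a measure"
  assumes K: "markov_kernel K" and L: "\<And>m. markov_kernel (L m)"
    and tv: "\<And>x. (\<lambda>m. SUP B\<in>sets borel. \<bar>measure (L m x) B - measure (K x) B\<bar>) \<longlonglongrightarrow> 0"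
    and f: "\<And>m. f m \<in> borel_measurable borel" "\<And>m x. \<bar>f m x\<bar> \<le> 1"
  shows "(\<lambda>m. markov_chain.partial_sum (L m) n (f m) x - markov_chain.partial_sum K n (f m) x) \<longlonglongrightarrow> 0"
proof -
  interpret K: markov_chain K by unfold_locales (rule K)
  interpret L: markov_chain "L m" for m by unfold_locales (rule L)
  have "(\<lambda>m. \<Sum>i<n. (L.trans_op m ^^ i) (f m) x - (K.trans_op ^^ i) (f m) x) \<longlonglongrightarrow> (\<Sum>i<n. 0)"
    by (intro tendsto_sum funpow_trans_op_tendsto[OF assms])
  then show ?thesis
    by (simp add: L.partial_sum_def K.partial_sum_def sum_subtractf)
qed

text \<open>Both invariant laws are within C / n of n-step averages, which reduces the claim to a
  fixed horizon. The supremum over sets is handled by a sequence of nearly optimal sets, whose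
  indicators are the varying test functions of \<open>partial_sum_tendsto\<close>.\<close>

lemma invariant_prob_tendsto:
  fixes K :: "'a::t1_space \<Rightarrow> 'a measure" and L :: "nat \<Rightarrow> 'a \<Rightarrow> 'a measure"
  assumes K: "cesaro_ergodic_chain K C" and L: "\<And>m. cesaro_ergodic_chain (L m) C"
    and tv: "\<And>x. (\<lambda>m. SUP B\<in>sets borel. \<bar>measure (L m x) B - measure (K x) B\<bar>) \<longlonglongrightarrow> 0"
    and \<pi>: "invariant_prob K \<pi>" and \<rho>: "\<And>m. invariant_prob (L m) (\<rho> m)"
  shows "(\<lambda>m. SUP B\<in>sets borel. \<bar>measure (\<rho> m) B - measure \<pi> B\<bar>) \<longlonglongrightarrow> 0"
proof -
  interpret K: cesaro_ergodic_chain K C by (rule K)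
  interpret L: cesaro_ergodic_chain "L m" C for m by (rule L)
  have p: "prob_space \<pi>" "prob_space (\<rho> m)" and s: "sets \<pi> = sets borel" "sets (\<rho> m) = sets borel" for m
    using \<pi> \<rho>[of m] by (simp_all add: invariant_prob_def)
  let ?a = "\<lambda>m. SUP B\<in>sets borel. \<bar>measure (\<rho> m) B - measure \<pi> B\<bar>"
  have a0: "0 \<le> ?a m" for m
    using le_total_variation[OF p(2,1), of "{}" borel m] by simp
  have "\<exists>B\<in>sets borel. ?a m - 1 / real (Suc m) < \<bar>measure (\<rho> m) B - measure \<pi> B\<bar>" for m
  proof -
    have "?a m - 1 / real (Suc m) < ?a m" by simp
    then show ?thesis
      by (subst (asm) less_cSUP_iff) (auto intro!: bdd_aboveI[of _ 1] prob_diff_le_1 p)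
  qed
  then obtain B where B: "\<And>m. B m \<in> sets borel"
    and aB: "\<And>m. ?a m - 1 / real (Suc m) < \<bar>measure (\<rho> m) (B m) - measure \<pi> (B m)\<bar>"
    by metis
  define f where "f m = (indicator (B m) :: 'a \<Rightarrow> real)" for m
  have f: "f m \<in> borel_measurable borel" "\<And>x. \<bar>f m x\<bar> \<le> 1" for m
    using B[of m] by (auto simp: f_def indicator_def)
  fix x0 :: 'a
  let ?D = "\<lambda>n m. L.partial_sum m n (f m) x0 - K.partial_sum n (f m) x0"
  have bound: "?a m \<le> 1 / real (Suc m) + \<bar>?D n m\<bar> / n + 2 * C / n" if n: "0 < n" for m n
  proof -
    have "\<bar>L.partial_sum m n (f m) x0 / n - measure (\<rho> m) (B m)\<bar> \<le> C / n"
      using L.average_near_invariant[OF \<rho> f n, of m m x0] B s by (simp add: f_def)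
    moreover have "\<bar>K.partial_sum n (f m) x0 / n - measure \<pi> (B m)\<bar> \<le> C / n"
      using K.average_near_invariant[OF \<pi> f n, of m x0] B s by (simp add: f_def)
    moreover have "L.partial_sum m n (f m) x0 / n - K.partial_sum n (f m) x0 / n = ?D n m / n"
      by (simp add: diff_divide_distrib)
    moreover have "\<bar>?D n m / n\<bar> = \<bar>?D n m\<bar> / n" by simp
    moreover have "2 * C / n = C / n + C / n" by simp
    ultimately show ?thesis using aB[of m] by linarith
  qed
  show ?thesis
  proof (rule LIMSEQ_I)
    fix r :: real assume r: "0 < r"
    \<comment> \<open>The horizon n is chosen first, making the ergodic error small for all m at
      once; for this n the difference of the partial sums then tends to 0 in m.\<close>
    have "(\<lambda>n. 2 * C / real n) \<longlonglongrightarrow> 0" by (rule lim_const_over_n)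
    from LIMSEQ_D[OF this, of "r / 2"] r obtain n0 where n0: "\<And>n. n0 \<le> n \<Longrightarrow> \<bar>2 * C / real n\<bar> < r / 2"
      by auto
    define n where "n = Suc n0"
    have n: "0 < n" "2 * C / real n < r / 2"
      using n0[of n] abs_ge_self[of "2 * C / real n"] by (simp_all only: n_def) auto
    have "(\<lambda>m. 1 / real (Suc m) + \<bar>?D n m\<bar> / n) \<longlonglongrightarrow> 0 + \<bar>0\<bar> / real n"
      using n(1) by (intro tendsto_add tendsto_divide tendsto_rabs tendsto_const LIMSEQ_Suc[OF lim_const_over_n]
          partial_sum_tendsto[OF K.K L.K tv f]) auto
    from LIMSEQ_D[OF this, of "r / 2"] r obtain N
      where N: "\<And>m. N \<le> m \<Longrightarrow> \<bar>1 / real (Suc m) + \<bar>?D n m\<bar> / n\<bar> < r / 2"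
      by auto
    have "norm (?a m - 0) < r" if "N \<le> m" for m
      using N[OF that] bound[OF n(1), of m] n(2) a0[of m] unfolding real_norm_def diff_0_right by linarith
    then show "\<exists>N. \<forall>m\<ge>N. norm (?a m - 0) < r" by blast
  qed
qed

section \<open>From (EC), (ER) and (PR) to constants shared by all controls\<close>

text \<open>The two events differ only on paths without a cycle end, where \<open>LEAST\<close> is
  arbitrary, and these form a null set. Intersecting with \<open>R\<close> gives a set over which
  (ER) quantifies.\<close>

lemma (in markov_chain) measure_cycle_end:
  assumes R: "R \<in> sets borel" "R1 \<in> sets borel"
    and cycle: "\<And>k. (\<Sum>j<k. measure (law x) {\<omega>. \<forall>s\<le>j. \<not> cycle_end R1 R s \<omega>}) \<le> T"
    and B: "B \<in> sets borel"
  shows "measure (law x) {\<omega>. \<omega> (LEAST s. cycle_end R1 R s \<omega>) \<in> B}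
    = measure (law x) {\<omega>. \<exists>t. cycle_time R1 R \<omega> = enat t \<and> \<omega> t \<in> B \<inter> R}"
proof -
  let ?N = "\<lambda>\<omega>. LEAST s. cycle_end R1 R s \<omega>"
  note ad = adapted_cycle_end[OF R]
  have ct: "cycle_time R1 R \<omega> = (if \<exists>s. cycle_end R1 R s \<omega> then enat (?N \<omega>) else \<infinity>)" for \<omega>
    unfolding cycle_time_eq by (rule INF_enat_eq_LEAST)
  have eq: "{\<omega>. \<exists>t. cycle_time R1 R \<omega> = enat t \<and> \<omega> t \<in> B \<inter> R}
    = {\<omega>. (\<exists>s. cycle_end R1 R s \<omega>) \<and> \<omega> (?N \<omega>) \<in> B \<inter> R}"
    by (auto simp: ct split: if_splits)
  have m: "Measurable.pred (law x) (\<lambda>\<omega>. \<omega> (?N \<omega>) \<in> A)" if "A \<in> sets borel" for A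
  proof -
    have "Measurable.pred borel (\<lambda>y. y \<in> A)" using that by (simp add: pred_def)
    from measurable_compose[OF first_measurable[OF ad] this] show ?thesis .
  qed
  have m': "Measurable.pred (law x) (\<lambda>\<omega>. (\<exists>s. cycle_end R1 R s \<omega>) \<and> \<omega> (?N \<omega>) \<in> B \<inter> R)"
    using B R by (intro pred_intros_logic(3) m pred_intros_countable(2) adapted_measurable[OF ad]) auto
  \<comment> \<open>Only the almost sure finiteness is taken from \<open>dynkin_bound\<close>, so
    the zero function serves as \<open>\<phi>\<close>.\<close>
  have "AE \<omega> in law x. \<exists>s. cycle_end R1 R s \<omega>"
    by (rule dynkin_bound(1)[OF ad _ _ _ cycle, of "\<lambda>_. 0" 0 0]) (simp_all add: trans_op_def)
  then have "AE \<omega> in law x. \<omega> \<in> {\<omega>. \<omega> (?N \<omega>) \<in> B} \<longleftrightarrow>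
      \<omega> \<in> {\<omega>. (\<exists>s. cycle_end R1 R s \<omega>) \<and> \<omega> (?N \<omega>) \<in> B \<inter> R}"
  proof eventually_elim
    case (elim \<omega>)
    then have "cycle_end R1 R (?N \<omega>) \<omega>" by (rule LeastI_ex)
    then show ?case using elim by (auto simp: cycle_end_def)
  qed
  then show ?thesis
    unfolding eq using m[OF B] m' by (intro measure_eq_AE) (simp_all add: pred_def)
qed

lemma cesaro_ergodic_chain_uniform:
  fixes P :: "'b \<Rightarrow> 'a::metric_space \<Rightarrow> 'a measure" and \<U> :: "('a \<Rightarrow> 'b) set"
  assumes kernel: "\<And>v. v \<in> \<U> \<Longrightarrow> markov_kernel (ctrl_kernel P v)"
    and balls: "concentric_balls R R1"
    and EC: "cond_EC P \<U> R R1" and ER: "cond_ER P \<U> R R1" and PR: "cond_PR P \<U> R"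
  obtains C where "\<And>v. v \<in> \<U> \<Longrightarrow> cesaro_ergodic_chain (ctrl_kernel P v) C"
proof -
  obtain z r r1 where "0 < r" "R \<in> {ball z r, cball z r}" "R1 \<in> {ball z r1, cball z r1}"
    using balls unfolding concentric_balls_def by blast
  then have "z \<in> R" and R: "R \<in> sets borel" "R1 \<in> sets borel" by auto
  define S1 where "S1 = (SUP x\<in>R. SUP v\<in>\<U>. \<integral>\<^sup>+\<omega>. (ennreal_of_enat (cycle_time R1 R \<omega>))\<^sup>2 \<partial>path_law P v x)"
  define S2 where "S2 = (SUP x. SUP v\<in>\<U>. \<integral>\<^sup>+\<omega>. ennreal_of_enat (hit R \<omega>) \<partial>path_law P v x)"
  define \<Delta> where "\<Delta> = (SUP x\<in>R. SUP x'\<in>R. SUP v\<in>\<U>. SUP B\<in>sets (restrict_space borel R).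
        \<bar>return_prob P R R1 v x B - return_prob P R R1 v x' B\<bar>)"
  \<comment> \<open>Finiteness of the suprema is what makes the passage to real constants
    lossless.\<close>
  have S1: "S1 = ennreal (enn2real S1)" and S2: "S2 = ennreal (enn2real S2)"
    using EC PR unfolding cond_EC_def cond_PR_def S1_def[symmetric] S2_def[symmetric] by simp_all
  have \<Delta>1: "\<Delta> < 1" using ER unfolding cond_ER_def \<Delta>_def .
  have "cesaro_ergodic_chain (ctrl_kernel P v) (4 * enn2real S2 + 8 * enn2real S1 / (1 - \<Delta>))" if v: "v \<in> \<U>" for v
  proof -
    interpret markov_chain "ctrl_kernel P v" by unfold_locales (rule kernel[OF v])
    have cycle: "(\<Sum>j<k. measure (law x) {\<omega>. \<forall>s\<le>j. \<not> cycle_end R1 R s \<omega>}) \<le> enn2real S1" if "x \<in> R" for x k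
    proof (rule sum_alive_bound[OF adapted_cycle_end[OF R]])
      have "(\<integral>\<^sup>+\<omega>. ennreal_of_enat (INF s\<in>{s. cycle_end R1 R s \<omega>}. enat s) \<partial>law x)
        \<le> (\<integral>\<^sup>+\<omega>. (ennreal_of_enat (cycle_time R1 R \<omega>))\<^sup>2 \<partial>law x)"
        unfolding cycle_time_eq by (intro nn_integral_mono ennreal_of_enat_le_power2)
      also have "\<dots> \<le> S1"
        unfolding S1_def using that v by (intro SUP_upper2[of x] SUP_upper) auto
      finally show "(\<integral>\<^sup>+\<omega>. ennreal_of_enat (INF s\<in>{s. cycle_end R1 R s \<omega>}. enat s) \<partial>law x) \<le> ennreal (enn2real S1)"
        using S1 by simp
    qed simp
    have hitting: "(\<Sum>j<k. measure (law x) {\<omega>. \<forall>s\<le>j. \<not> \<omega> s \<in> R}) \<le> enn2real S2" for x k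
    proof (rule sum_alive_bound[OF adapted_hit[OF R(1)]])
      have "(\<integral>\<^sup>+\<omega>. ennreal_of_enat (INF s\<in>{s. \<omega> s \<in> R}. enat s) \<partial>law x) \<le> S2"
        unfolding S2_def hit_def using v by (intro SUP_upper2[of x] SUP_upper) auto
      then show "(\<integral>\<^sup>+\<omega>. ennreal_of_enat (INF s\<in>{s. \<omega> s \<in> R}. enat s) \<partial>law x) \<le> ennreal (enn2real S2)"
        using S2 by simp
    qed simp
    have mixing: "\<bar>measure (law x) {\<omega>. \<omega> (LEAST s. cycle_end R1 R s \<omega>) \<in> B}
       - measure (law x') {\<omega>. \<omega> (LEAST s. cycle_end R1 R s \<omega>) \<in> B}\<bar> \<le> \<Delta>"
      if x: "x \<in> R" and x': "x' \<in> R" and B: "B \<in> sets borel" for x x' B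
    proof -
      \<comment> \<open>The suprema in (ER) are taken in the reals, where an upper bound can be read
        off only from a bounded nonempty family. Differences of probabilities are at most 1, which
        bounds each of the four nested levels in turn.\<close>
      define g where "g x x' w A = \<bar>return_prob P R R1 w x A - return_prob P R R1 w x' A\<bar>" for x x' w A
      let ?S = "sets (restrict_space borel R)"
      have BR: "B \<inter> R \<in> ?S" using B R(1) by (auto simp: sets_restrict_space)
      have g1: "g x x' w A \<le> 1" if "w \<in> \<U>" for x x' w A
        unfolding g_def return_prob_def using prob_space_chain_law[OF kernel[OF that]]
        by (intro prob_diff_le_1)
      have s1: "(SUP A\<in>?S. g x x' w A) \<le> 1" if "w \<in> \<U>" for x x' w
        using BR g1[OF that] by (rule le_cSUP_bounded(2))
      have s2: "(SUP w\<in>\<U>. SUP A\<in>?S. g x x' w A) \<le> 1" for x x'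
        using v s1 by (rule le_cSUP_bounded(2))
      have s3: "(SUP x'\<in>R. SUP w\<in>\<U>. SUP A\<in>?S. g x x' w A) \<le> 1" for x
        using x' s2 by (rule le_cSUP_bounded(2))
      have "g x x' v (B \<inter> R) \<le> (SUP A\<in>?S. g x x' v A)"
        using BR g1[OF v] by (rule le_cSUP_bounded(1))
      also have "\<dots> \<le> (SUP w\<in>\<U>. SUP A\<in>?S. g x x' w A)"
        using v s1 by (rule le_cSUP_bounded(1))
      also have "\<dots> \<le> (SUP x'\<in>R. SUP w\<in>\<U>. SUP A\<in>?S. g x x' w A)"
        using x' s2 by (rule le_cSUP_bounded(1))
      also have "\<dots> \<le> \<Delta>"
        unfolding \<Delta>_def g_def[symmetric] using x s3 by (rule le_cSUP_bounded(1))
      finally show ?thesis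
        using measure_cycle_end[OF R cycle[OF x] B] measure_cycle_end[OF R cycle[OF x'] B]
        by (simp add: g_def return_prob_def)
    qed
    interpret regenerative_chain "ctrl_kernel P v" R R1 "enn2real S1" "enn2real S2" \<Delta>
      using R \<open>z \<in> R\<close> cycle hitting mixing \<Delta>1 by unfold_locales auto
    show ?thesis
      by unfold_locales (rule partial_sum_oscillation)
  qed
  then show thesis by (rule that)
qed

theorem theorem4:
  fixes P :: "'b::topological_space \<Rightarrow> 'a::polish_space \<Rightarrow> 'a measure"
    and U :: "'b set"
    and \<U> :: "('a \<Rightarrow> 'b) set"
    and R R1 :: "'a set"
    and u :: "'a \<Rightarrow> 'b"
    and un :: "nat \<Rightarrow> 'a \<Rightarrow> 'b"
    and c :: "'a \<Rightarrow> 'b \<Rightarrow> real"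
  assumes "compact U"
    and "\<U> \<subseteq> borel \<rightarrow>\<^sub>M restrict_space borel U"
    and "\<And>a. a \<in> U \<Longrightarrow> markov_kernel (P a)"
    and "\<And>v. v \<in> \<U> \<Longrightarrow> markov_kernel (ctrl_kernel P v)"
    and "concentric_balls R R1" and "R \<subseteq> R1"
    and "cond_EC P \<U> R R1" and "cond_ER P \<U> R R1" and "cond_PR P \<U> R"
    and "u \<in> \<U>" and "\<And>n. un n \<in> \<U>"
    and "\<And>x. (\<lambda>n. un n x) \<longlonglongrightarrow> u x"
    and "\<And>x. (\<lambda>n. SUP B\<in>sets borel. \<bar>measure (P (un n x) x) B - measure (P (u x) x) B\<bar>) \<longlonglongrightarrow> 0"
    and "\<exists>C. \<forall>x. \<forall>a\<in>U. \<bar>c x a\<bar> \<le> C"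
    and "(\<lambda>(x, a). c x a) \<in> borel_measurable (borel \<Otimes>\<^sub>M restrict_space borel U)"
    and "\<And>x. continuous_on U (c x)"
  shows "(\<lambda>n. SUP B\<in>sets borel. \<bar>measure (inv_law P (un n)) B - measure (inv_law P u) B\<bar>) \<longlonglongrightarrow> 0
    \<and> (\<forall>x. (\<lambda>n. avg_cost P c x (un n)) \<longlonglongrightarrow> avg_cost P c x u
         \<and> avg_cost P c x u = ereal (\<integral>y. c y (u y) \<partial>inv_law P u))"
proof -
  obtain C where C: "\<And>v. v \<in> \<U> \<Longrightarrow> cesaro_ergodic_chain (ctrl_kernel P v) C"
    using cesaro_ergodic_chain_uniform[OF assms(4,5,7-9)] by blast
  \<comment> \<open>\<open>inv_law\<close> is a definite description; existence and uniqueness for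
    each control give it its meaning.\<close>
  have inv: "invariant_prob (ctrl_kernel P v) (inv_law P v)" if "v \<in> \<U>" for v
    unfolding inv_law_def by (rule cesaro_ergodic_chain.invariant_prob_THE[OF C[OF that]])
  have prob: "prob_space (inv_law P v)" and sets: "sets (inv_law P v) = sets borel" if "v \<in> \<U>" for v
    using inv[OF that] by (simp_all add: invariant_prob_def)
  let ?a = "\<lambda>n. SUP B\<in>sets borel. \<bar>measure (inv_law P (un n)) B - measure (inv_law P u) B\<bar>"
  have tv: "?a \<longlonglongrightarrow> 0"
    using C[OF assms(10)] C[OF assms(11)] _ inv[OF assms(10)] inv[OF assms(11)]
    by (rule invariant_prob_tendsto) (use assms(13) in \<open>simp add: ctrl_kernel_def\<close>)
  obtain b where b: "\<And>x a. a \<in> U \<Longrightarrow> \<bar>c x a\<bar> \<le> b" using assms(14) by blast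
  define f where "f v y = c y (v y)" for v y
  have in_U: "v y \<in> U" if "v \<in> \<U>" for v y
    using assms(2) that measurable_space[of v borel "restrict_space borel U" y] by (auto simp: space_restrict_space)
  have f_meas: "f v \<in> borel_measurable borel" if "v \<in> \<U>" for v
  proof -
    have "v \<in> borel \<rightarrow>\<^sub>M restrict_space borel U" using assms(2) that by blast
    then have "(\<lambda>y. (y, v y)) \<in> borel \<rightarrow>\<^sub>M borel \<Otimes>\<^sub>M restrict_space borel U"
      by (intro measurable_Pair) auto
    from measurable_compose[OF this assms(15)] show ?thesis
      by (simp add: f_def[abs_def])
  qed
  have f_bound: "\<bar>f v y\<bar> \<le> b" if "v \<in> \<U>" for v y
    unfolding f_def by (rule b[OF in_U[OF that]])
  \<comment> \<open>The averages converge for every control of the family, so the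
    \<open>liminf\<close> is a limit independent of x.\<close>
  have cost: "avg_cost P c x v = ereal (\<integral>y. f v y \<partial>inv_law P v)" if v: "v \<in> \<U>" for x v
  proof -
    have "(\<lambda>n. 1 / real n * (\<integral>\<omega>. (\<Sum>i<n. f v (\<omega> i)) \<partial>path_law P v x)) \<longlonglongrightarrow> (\<integral>y. f v y \<partial>inv_law P v)"
      by (rule cesaro_ergodic_chain.path_average_tendsto[OF C[OF v] inv[OF v] f_meas[OF v] f_bound[OF v]])
    then have "(\<lambda>n. ereal (1 / real n * (\<integral>\<omega>. (\<Sum>i<n. c (\<omega> i) (v (\<omega> i))) \<partial>path_law P v x)))
        \<longlonglongrightarrow> ereal (\<integral>y. f v y \<partial>inv_law P v)"
      unfolding f_def by (rule tendsto_ereal)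
    then show ?thesis
      unfolding avg_cost_def by (intro lim_imp_Liminf) simp_all
  qed
  \<comment> \<open>Measure and integrand both vary with n. The measure is exchanged first, with an
    error controlled by total variation for any integrand bounded by \<open>b\<close>; under the
    fixed law of \<open>u\<close>, continuity of the cost in the control and dominated convergence
    do the rest.\<close>
  have "(\<lambda>n. (\<integral>y. f (un n) y \<partial>inv_law P (un n)) - (\<integral>y. f (un n) y \<partial>inv_law P u)) \<longlonglongrightarrow> 0"
  proof (rule Lim_null_comparison)
    have ab: "- b \<le> f (un n) y" "f (un n) y \<le> b" for n y
      using f_bound[OF assms(11), of n y] by (simp_all add: abs_le_iff)
    have "\<bar>(\<integral>y. f (un n) y \<partial>inv_law P (un n)) - (\<integral>y. f (un n) y \<partial>inv_law P u)\<bar> \<le> ?a n * (b - (- b))" for n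
      by (rule total_variation_integral[OF prob[OF assms(11)] sets[OF assms(11)] prob[OF assms(10)] sets[OF assms(10)]
            f_meas[OF assms(11)] ab])
        (rule le_total_variation[OF prob[OF assms(11)] prob[OF assms(10)]])
    then show "\<forall>\<^sub>F n in sequentially. norm ((\<integral>y. f (un n) y \<partial>inv_law P (un n)) - (\<integral>y. f (un n) y \<partial>inv_law P u))
        \<le> ?a n * (b - (- b))"
      by simp
    show "(\<lambda>n. ?a n * (b - (- b))) \<longlonglongrightarrow> 0"
      using tendsto_mult_right[OF tv, of "b - (- b)"] by (simp only: mult_zero_left)
  qed
  moreover have "(\<lambda>n. \<integral>y. f (un n) y \<partial>inv_law P u) \<longlonglongrightarrow> (\<integral>y. f u y \<partial>inv_law P u)"
  proof (rule integral_dominated_convergence[where w = "\<lambda>_. b"])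
    interpret prob_space "inv_law P u" by (rule prob[OF assms(10)])
    show "f u \<in> borel_measurable (inv_law P u)" "f (un n) \<in> borel_measurable (inv_law P u)" for n
      using f_meas assms(10,11) by (simp_all add: measurable_cong_sets[OF sets[OF assms(10)] refl])
    show "integrable (inv_law P u) (\<lambda>_. b)" by simp
    show "AE y in inv_law P u. (\<lambda>n. f (un n) y) \<longlonglongrightarrow> f u y"
      unfolding f_def
      by (intro AE_I2 continuous_on_tendsto_compose[OF assms(16) assms(12)] in_U assms(10)
          always_eventually allI in_U[OF assms(11)])
    show "AE y in inv_law P u. norm (f (un n) y) \<le> b" for n
      using f_bound[OF assms(11)] by simp
  qed
  ultimately have "(\<lambda>n. \<integral>y. f (un n) y \<partial>inv_law P (un n)) \<longlonglongrightarrow> (\<integral>y. f u y \<partial>inv_law P u)"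
    by (rule Lim_transform[rotated])
  then have "(\<lambda>n. avg_cost P c x (un n)) \<longlonglongrightarrow> avg_cost P c x u" for x
    unfolding cost[OF assms(10)] cost[OF assms(11)] by (rule tendsto_ereal)
  moreover have "avg_cost P c x u = ereal (\<integral>y. c y (u y) \<partial>inv_law P u)" for x
    unfolding cost[OF assms(10)] f_def ..
  ultimately show ?thesis using tv by blast
qed

end
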